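(* Let $a,b\in B(\mathcal H)$ be bounded self-adjoint operators, let $s,t\in\mathbb R$, and put $$w:=w_{a,b}(s,t):=e^{-isa}e^{-itb}e^{isa}e^{itb}.$$ Then $$C_{a,b}(s,t)=\bigl\|\mathrm{id}-\operatorname{Ad}_w\bigr\|_{\mathrm{cb}}=2\inf_{\lambda\in\mathbb C}\|w-\lambda1\|=2\sqrt{1-\nu(w)^2}=2\sin\Bigl(\tfrac12\min\{\Theta(w),\pi\}\Bigr).$$
   Context: $\mathcal H$ is a Hilbert space, $\operatorname{Ad}_u(x)=u^*xu$ for unitary $u$, and $\|\cdot\|_{\mathrm{cb}}$ is the completely bounded norm of maps on $B(\mathcal H)$. For bounded self-adjoint $a,b$, $$C_{a,b}(s,t):=\bigl\|\operatorname{Ad}_{e^{isa}}\circ\operatorname{Ad}_{e^{itb}}-\operatorname{Ad}_{e^{itb}}\circ\operatorname{Ad}_{e^{isa}}\bigr\|_{\mathrm{cb}}.$$ For a unitary $w\in B(\mathcal H)$: $\nu(w):=\operatorname{dist}(0,\operatorname{conv}\sigma(w))$ is the distance in $\mathbb C$ from $0$ to the convex hull of the spectrum $\sigma(w)$, and $\Theta(w)\in[0,2\pi]$ is the length of a shortest closed arc of the unit circle $\mathbb T$ containing $\sigma(w)$ (a single point counts as an arc of length $0$). *)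

theory Defs
  imports "HOL-Analysis.Analysis"
begin

section \<open>Complex Hilbert spaces\<close>

class scaleC =
  fixes scaleC :: "complex \<Rightarrow> 'a \<Rightarrow> 'a"  (infixr \<open>*\<^sub>C\<close> 75)

class complex_vector = real_vector + scaleC +
  assumes scaleC_add_right: "c *\<^sub>C (x + y) = c *\<^sub>C x + c *\<^sub>C y"
    and scaleC_add_left: "(c + d) *\<^sub>C x = c *\<^sub>C x + d *\<^sub>C x"
    and scaleC_scaleC: "c *\<^sub>C d *\<^sub>C x = (c * d) *\<^sub>C x"
    and scaleC_one: "1 *\<^sub>C x = x"
    and scaleR_scaleC: "r *\<^sub>R x = complex_of_real r *\<^sub>C x"

text \<open>The inner product is conjugate-linear in its first argument.  Positive
  definiteness is contained in the last axiom, since the norm is one.\<close>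

class complex_hilbert_space = complex_vector + banach +
  fixes cinner :: "'a \<Rightarrow> 'a \<Rightarrow> complex"
  assumes cinner_commute: "cinner x y = cnj (cinner y x)"
    and cinner_add_right: "cinner x (y + z) = cinner x y + cinner x z"
    and cinner_scaleC_right: "cinner x (c *\<^sub>C y) = c * cinner x y"
    and cinner_norm: "cinner x x = complex_of_real ((norm x)\<^sup>2)"

class nonzero_complex_hilbert_space = complex_hilbert_space +
  assumes ex_nonzero: "\<exists>x. x \<noteq> 0"


section \<open>The Banach algebra of bounded complex-linear operators\<close>

lemma scaleC_zero_right: "c *\<^sub>C 0 = (0::'a::complex_vector)"
  using scaleC_add_right[of c "0::'a" 0] by simp

typedef (overloaded) 'a bounded_op =
  "{T :: 'a::complex_hilbert_space \<Rightarrow>\<^sub>L 'a. \<forall>c x. blinfun_apply T (c *\<^sub>C x) = c *\<^sub>C blinfun_apply T x}"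
  morphisms blinfun_of_op Bounded_Op
  by (rule exI[of _ 0]) (simp add: scaleC_zero_right)

setup_lifting type_definition_bounded_op

lift_definition op_apply :: "'a::complex_hilbert_space bounded_op \<Rightarrow> 'a \<Rightarrow> 'a"
  is blinfun_apply .

lemma op_eqI: "(\<And>x. op_apply S x = op_apply T x) \<Longrightarrow> S = T"
  by transfer (rule blinfun_eqI)

lemma op_apply_scaleC: "op_apply T (c *\<^sub>C x) = c *\<^sub>C op_apply T x"
  by transfer simp

lemma bounded_linear_op_apply: "bounded_linear (op_apply T)"
  by transfer (rule blinfun.bounded_linear_right)

lemma scaleC_minus_right: "c *\<^sub>C (- x) = - (c *\<^sub>C (x::'a::complex_vector))"
  using scaleC_add_right[of c x "- x"] by (simp add: scaleC_zero_right eq_neg_iff_add_eq_0 add.commute)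

lemma scaleC_diff_right: "c *\<^sub>C (x - y) = c *\<^sub>C x - c *\<^sub>C (y::'a::complex_vector)"
  using scaleC_add_right[of c x "- y"] by (simp add: scaleC_minus_right)

lemma scaleC_left_commute: "c *\<^sub>C d *\<^sub>C x = d *\<^sub>C c *\<^sub>C (x::'a::complex_vector)"
  by (simp add: scaleC_scaleC mult.commute)

lemma norm_scaleC:
  fixes x :: "'a::complex_hilbert_space"
  shows "norm (c *\<^sub>C x) = cmod c * norm x"
proof -
  have "complex_of_real ((norm (c *\<^sub>C x))\<^sup>2) = cinner (c *\<^sub>C x) (c *\<^sub>C x)"
    by (rule cinner_norm[symmetric])
  also have "\<dots> = c * cinner (c *\<^sub>C x) x"
    by (rule cinner_scaleC_right)
  also have "cinner (c *\<^sub>C x) x = cnj (c * cinner x x)"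
    by (metis cinner_commute cinner_scaleC_right)
  also have "c * cnj (c * cinner x x) = complex_of_real ((cmod c * norm x)\<^sup>2)"
    by (simp add: cinner_norm power_mult_distrib mult.assoc[symmetric] flip: complex_norm_square)
  finally have "(norm (c *\<^sub>C x))\<^sup>2 = (cmod c * norm x)\<^sup>2"
    by (simp only: of_real_eq_iff)
  then show ?thesis
    by (rule power2_eq_imp_eq) simp_all
qed

lemma bounded_linear_scaleC: "bounded_linear (\<lambda>x::'a::complex_hilbert_space. c *\<^sub>C x)"
  by (rule bounded_linear_intro[where K = "cmod c"])
    (simp_all add: scaleC_add_right scaleR_scaleC scaleC_left_commute[of c] norm_scaleC mult.commute)

instantiation bounded_op :: (complex_hilbert_space) real_normed_vector
begin

lift_definition zero_bounded_op :: "'a bounded_op" is 0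
  by (simp add: scaleC_zero_right)

lift_definition plus_bounded_op :: "'a bounded_op \<Rightarrow> 'a bounded_op \<Rightarrow> 'a bounded_op" is "(+)"
  by (simp add: blinfun.add_left scaleC_add_right)

lift_definition minus_bounded_op :: "'a bounded_op \<Rightarrow> 'a bounded_op \<Rightarrow> 'a bounded_op" is "(-)"
  by (simp add: blinfun.diff_left scaleC_diff_right)

lift_definition uminus_bounded_op :: "'a bounded_op \<Rightarrow> 'a bounded_op" is uminus
  by (simp add: blinfun.minus_left scaleC_minus_right)

lift_definition scaleR_bounded_op :: "real \<Rightarrow> 'a bounded_op \<Rightarrow> 'a bounded_op" is scaleR
  by (simp add: blinfun.scaleR_left scaleR_scaleC scaleC_left_commute)

lift_definition norm_bounded_op :: "'a bounded_op \<Rightarrow> real" is norm .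

definition dist_bounded_op :: "'a bounded_op \<Rightarrow> 'a bounded_op \<Rightarrow> real"
  where "dist_bounded_op S T = norm (S - T)"

definition sgn_bounded_op :: "'a bounded_op \<Rightarrow> 'a bounded_op"
  where "sgn_bounded_op T = inverse (norm T) *\<^sub>R T"

definition uniformity_bounded_op :: "('a bounded_op \<times> 'a bounded_op) filter"
  where "uniformity_bounded_op = (INF e\<in>{0 <..}. principal {(S, T). dist S T < e})"

definition open_bounded_op :: "'a bounded_op set \<Rightarrow> bool"
  where "open_bounded_op U = (\<forall>S\<in>U. \<forall>\<^sub>F (S', T) in uniformity. S' = S \<longrightarrow> T \<in> U)"

instance
proof
  fix S T U :: "'a bounded_op" and r q :: real
  show "S + T + U = S + (T + U)" "S + T = T + S" "0 + S = S" "- S + S = 0" "S - T = S + - T"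
    by (transfer; simp add: add.assoc add.commute)+
  show "r *\<^sub>R (S + T) = r *\<^sub>R S + r *\<^sub>R T" "(r + q) *\<^sub>R S = r *\<^sub>R S + q *\<^sub>R S"
    "r *\<^sub>R q *\<^sub>R S = (r * q) *\<^sub>R S" "1 *\<^sub>R S = S"
    by (transfer; simp add: scaleR_add_left scaleR_add_right)+
  show "dist S T = norm (S - T)"
    by (rule dist_bounded_op_def)
  show "sgn S = inverse (norm S) *\<^sub>R S"
    by (rule sgn_bounded_op_def)
  show "(uniformity :: ('a bounded_op \<times> 'a bounded_op) filter) = (INF e\<in>{0<..}. principal {(S, T). dist S T < e})"
    by (rule uniformity_bounded_op_def)
  show "open V = (\<forall>S\<in>V. \<forall>\<^sub>F (S', T) in uniformity. S' = S \<longrightarrow> T \<in> V)" for V :: "'a bounded_op set"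
    by (rule open_bounded_op_def)
  show "(norm S = 0) = (S = 0)"
    by transfer simp
  show "norm (r *\<^sub>R S) = \<bar>r\<bar> * norm S"
    by transfer simp
  show "norm (S + T) \<le> norm S + norm T"
    by transfer (rule norm_triangle_ineq)
qed

end

lemma blinfun_apply_scaleC:
  "blinfun_apply (Blinfun (\<lambda>x. c *\<^sub>C blinfun_apply T x)) = (\<lambda>x. c *\<^sub>C blinfun_apply T x)"
  for T :: "'a::real_normed_vector \<Rightarrow>\<^sub>L 'b::complex_hilbert_space"
  by (rule bounded_linear_Blinfun_apply)
    (rule bounded_linear_compose[OF bounded_linear_scaleC blinfun.bounded_linear_right])

instantiation bounded_op :: (complex_hilbert_space) complex_vector
begin

lift_definition scaleC_bounded_op :: "complex \<Rightarrow> 'a bounded_op \<Rightarrow> 'a bounded_op"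
  is "\<lambda>c T. Blinfun (\<lambda>x. c *\<^sub>C blinfun_apply T x)"
  unfolding blinfun_apply_scaleC by (simp add: scaleC_scaleC mult.commute)

instance
proof
  fix S T :: "'a bounded_op" and r :: real and c d :: complex
  have ap: "op_apply (c *\<^sub>C T) x = c *\<^sub>C op_apply T x" "op_apply (S + T) x = op_apply S x + op_apply T x"
    "op_apply (r *\<^sub>R T) x = r *\<^sub>R op_apply T x"
    for c r x and S T :: "'a bounded_op"
    by (transfer; simp add: blinfun_apply_scaleC blinfun.add_left blinfun.scaleR_left)+
  show "c *\<^sub>C (S + T) = c *\<^sub>C S + c *\<^sub>C T" "(c + d) *\<^sub>C S = c *\<^sub>C S + d *\<^sub>C S"
    "c *\<^sub>C d *\<^sub>C S = (c * d) *\<^sub>C S" "1 *\<^sub>C S = S" "r *\<^sub>R S = complex_of_real r *\<^sub>C S"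
    by (rule op_eqI, simp add: ap scaleC_add_right scaleC_add_left scaleC_scaleC scaleC_one scaleR_scaleC)+
qed

end

instantiation bounded_op :: (complex_hilbert_space) real_normed_algebra
begin

lift_definition times_bounded_op :: "'a bounded_op \<Rightarrow> 'a bounded_op \<Rightarrow> 'a bounded_op"
  is blinfun_compose
  by simp

instance
proof
  fix S T U :: "'a bounded_op" and r :: real
  show "S * T * U = S * (T * U)" "(S + T) * U = S * U + T * U" "S * (T + U) = S * T + S * U"
    "r *\<^sub>R S * T = r *\<^sub>R (S * T)" "S * r *\<^sub>R T = r *\<^sub>R (S * T)"
    by (transfer; rule blinfun_eqI; simp add: blinfun.bilinear_simps)+
  show "norm (S * T) \<le> norm S * norm T"
    by transfer (rule norm_blinfun_compose)
qed

end

instantiation bounded_op :: (nonzero_complex_hilbert_space) real_normed_algebra_1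
begin

lift_definition one_bounded_op :: "'a bounded_op" is id_blinfun
  by simp

instance
proof
  fix T :: "'a bounded_op"
  show "1 * T = T" "T * 1 = T"
    by (transfer; rule blinfun_eqI; simp)+
  obtain x :: 'a where x: "x \<noteq> 0"
    using ex_nonzero by blast
  show norm1: "norm (1 :: 'a bounded_op) = 1"
  proof (transfer, rule norm_blinfun_eqI[where x = x])
    show "1 \<le> norm (blinfun_apply id_blinfun x) / norm x"
      using x by simp
  qed simp_all
  show "(0 :: 'a bounded_op) \<noteq> 1"
    using norm1 by (metis norm_zero zero_neq_one)
qed

end

instance bounded_op :: (complex_hilbert_space) banach
proof
  fix X :: "nat \<Rightarrow> 'a bounded_op"
  assume X: "Cauchy X"
  have diff: "norm (blinfun_of_op S - blinfun_of_op T) = norm (S - T)" for S T :: "'a bounded_op"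
    by transfer simp
  have "Cauchy (\<lambda>n. blinfun_of_op (X n))"
    using X by (simp add: Cauchy_def dist_norm diff)
  then obtain L where L: "(\<lambda>n. blinfun_of_op (X n)) \<longlonglongrightarrow> L"
    using Cauchy_convergent_iff convergent_def by blast
  have lim: "(\<lambda>n. blinfun_apply (blinfun_of_op (X n)) x) \<longlonglongrightarrow> blinfun_apply L x" for x
    by (intro blinfun.tendsto L tendsto_const)
  have "blinfun_apply L (c *\<^sub>C x) = c *\<^sub>C blinfun_apply L x" for c x
  proof (rule LIMSEQ_unique)
    show "(\<lambda>n. blinfun_apply (blinfun_of_op (X n)) (c *\<^sub>C x)) \<longlonglongrightarrow> blinfun_apply L (c *\<^sub>C x)"
      by (rule lim)
    have "blinfun_apply (blinfun_of_op (X n)) (c *\<^sub>C x) = c *\<^sub>C blinfun_apply (blinfun_of_op (X n)) x" for n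
      using blinfun_of_op[of "X n"] by simp
    then show "(\<lambda>n. blinfun_apply (blinfun_of_op (X n)) (c *\<^sub>C x)) \<longlonglongrightarrow> c *\<^sub>C blinfun_apply L x"
      using bounded_linear.tendsto[OF bounded_linear_scaleC lim] by simp
  qed
  then have "blinfun_of_op (Bounded_Op L) = L"
    by (simp add: Bounded_Op_inverse)
  then have "norm (X n - Bounded_Op L) = norm (blinfun_of_op (X n) - L)" for n
    using diff[of "X n" "Bounded_Op L"] by simp
  then have "X \<longlonglongrightarrow> Bounded_Op L"
    using L by (simp add: LIMSEQ_iff)
  then show "convergent X"
    by (rule convergentI)
qed


section \<open>Adjoints and the spectrum\<close>

definition adjoint_op :: "'a::complex_hilbert_space bounded_op \<Rightarrow> 'a bounded_op"
  where "adjoint_op T = (THE S. \<forall>x y. cinner (op_apply S x) y = cinner x (op_apply T y))"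

definition selfadjoint_op :: "'a::complex_hilbert_space bounded_op \<Rightarrow> bool"
  where "selfadjoint_op T \<longleftrightarrow> adjoint_op T = T"

definition Ad :: "'a::complex_hilbert_space bounded_op \<Rightarrow> 'a bounded_op \<Rightarrow> 'a bounded_op"
  where "Ad u x = adjoint_op u * x * u"

definition spectrum_op :: "'a::nonzero_complex_hilbert_space bounded_op \<Rightarrow> complex set"
  where "spectrum_op T = {z. \<not> (\<exists>S. S * (T - z *\<^sub>C 1) = 1 \<and> (T - z *\<^sub>C 1) * S = 1)}"


section \<open>The completely bounded norm\<close>

text \<open>The norm of an operator matrix \<open>(A i j)\<close>, \<open>i, j < n\<close>, acting on the \<open>n\<close>-fold Hilbert
  space direct sum, i.e.\ the norm of \<open>M\<^sub>n(B(H))\<close>.  Entries with an index \<open>\<ge> n\<close> are ignored.\<close>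

definition matrix_norm :: "nat \<Rightarrow> (nat \<Rightarrow> nat \<Rightarrow> 'a::complex_hilbert_space bounded_op) \<Rightarrow> real"
  where "matrix_norm n A =
    (SUP x\<in>{x :: nat \<Rightarrow> 'a. L2_set (\<lambda>j. norm (x j)) {..<n} \<le> 1}.
       L2_set (\<lambda>i. norm (\<Sum>j<n. op_apply (A i j) (x j))) {..<n})"

text \<open>Extended-real valued, since a linear map need not be completely bounded.\<close>

definition cb_norm :: "('a::complex_hilbert_space bounded_op \<Rightarrow> 'a bounded_op) \<Rightarrow> ereal"
  where "cb_norm \<Phi> =
    (SUP n\<in>{1..}. SUP A\<in>{A. matrix_norm n A \<le> 1}. ereal (matrix_norm n (\<lambda>i j. \<Phi> (A i j))))"


section \<open>The quantities in the commutator formula\<close>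

definition cb_commutator ::
    "'a::nonzero_complex_hilbert_space bounded_op \<Rightarrow> 'a bounded_op \<Rightarrow> real \<Rightarrow> real \<Rightarrow> ereal"
  where "cb_commutator a b s t =
    (let u = exp ((\<i> * complex_of_real s) *\<^sub>C a); v = exp ((\<i> * complex_of_real t) *\<^sub>C b)
     in cb_norm (\<lambda>x. (Ad u \<circ> Ad v) x - (Ad v \<circ> Ad u) x))"

definition group_commutator ::
    "'a::nonzero_complex_hilbert_space bounded_op \<Rightarrow> 'a bounded_op \<Rightarrow> real \<Rightarrow> real \<Rightarrow> 'a bounded_op"
  where "group_commutator a b s t =
    exp (- (\<i> * complex_of_real s) *\<^sub>C a) * exp (- (\<i> * complex_of_real t) *\<^sub>C b) *
    exp ((\<i> * complex_of_real s) *\<^sub>C a) * exp ((\<i> * complex_of_real t) *\<^sub>C b)"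

definition spectral_dist :: "'a::nonzero_complex_hilbert_space bounded_op \<Rightarrow> real"
  where "spectral_dist w = infdist 0 (convex hull (spectrum_op w))"

text \<open>A closed arc of length \<open>l \<in> [0, 2\<pi>]\<close> is the image of an interval \<open>[\<alpha>, \<alpha> + l]\<close> under
  \<open>\<theta> \<mapsto> e\<^sup>i\<^sup>\<theta>\<close>; the infimum over the arcs containing the spectrum is attained.\<close>

definition spectral_arc :: "'a::nonzero_complex_hilbert_space bounded_op \<Rightarrow> real"
  where "spectral_arc w =
    Inf {l. 0 \<le> l \<and> l \<le> 2 * pi \<and> (\<exists>\<alpha>. spectrum_op w \<subseteq> cis ` {\<alpha>..\<alpha> + l})}"

end

(* With u = e^{isa}, v = e^{itb} one has uv = vu w, so the commutator of Ad_u and Ad_v is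
   id - Ad_w followed by the complete isometry Ad_{vu}.  Since x - w^* x w = w^*((w - z)x - x(w - z)),
   the cb norm of id - Ad_w is at most 2 |w - z| for every scalar z.  Let c be the point of
   conv sigma(w) closest to 0.  The numerical range of w lies in every closed half-plane containing
   sigma(w), so Re (cnj c <x, wx>) >= |c|^2 for unit vectors x, and hence |w - c| <= sqrt(1 - |c|^2).
   Conversely, c is approximated by <xi, (w + ... + w) xi> for unit vectors xi of a finite direct sum
   of copies of H, and applying id - Ad_w to the reflection 2|xi><xi| - 1 shows that the cb norm is
   at least 2 sqrt(1 - |c|^2). *)

theory Submission
  imports Defs
begin

text \<open>The scalar c is the right one for a geometric reason. On the unit circle |mu - c|^2 = 1
  - 2 Re (cnj c mu) + |c|^2, so the half-plane inequality says that the disc about c of radius sqrt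
  (1 - |c|^2) contains the spectrum; the same expansion applied to |w x - c x|^2 gives the operator
  estimate. In place of a spectral measure the proof works with approximate eigenvectors, and the
  half-plane property of the numerical range comes from factoring a quadratic polynomial in w.
  Direct sums enter the lower bound because one approximate eigenvector sees one spectral value,
  while c is a convex combination of several. Placing the vectors in different summands removes all
  cross terms between them, and this is where the freedom of matrix amplifications in the cb norm is
  used.\<close>

section \<open>Inner products and orthogonal projections\<close>

lemma cinner_add_left: "cinner (x + y) z = cinner x z + cinner (y::'a::complex_hilbert_space) z"
  by (metis cinner_add_right cinner_commute complex_cnj_add)

lemma cinner_scaleC_left: "cinner (c *\<^sub>C x) y = cnj c * cinner x (y::'a::complex_hilbert_space)"
  by (metis cinner_scaleC_right cinner_commute complex_cnj_mult)

lemma scaleC_zero_left: "0 *\<^sub>C x = (0::'a::complex_vector)"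
  using scaleR_scaleC[of 0 x] by simp

lemma scaleC_minus_one: "(- 1) *\<^sub>C x = - (x::'a::complex_vector)"
  using scaleR_scaleC[of "- 1" x] by simp

lemma scaleC_minus_left: "(- c) *\<^sub>C x = - (c *\<^sub>C (x::'a::complex_vector))"
  using scaleC_scaleC[of "- 1" c x] by (simp add: scaleC_minus_one)

lemma scaleC_diff_left: "(c - d) *\<^sub>C x = c *\<^sub>C x - d *\<^sub>C (x::'a::complex_vector)"
  using scaleC_add_left[of c "- d" x] by (simp add: scaleC_minus_left)

lemma scaleC_sum_right: "c *\<^sub>C (\<Sum>i\<in>I. f i) = (\<Sum>i\<in>I. c *\<^sub>C (f i::'a::complex_vector))"
  by (induction I rule: infinite_finite_induct) (simp_all add: scaleC_zero_right scaleC_add_right)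

lemma scaleC_sum_left: "(\<Sum>i\<in>I. f i) *\<^sub>C x = (\<Sum>i\<in>I. f i *\<^sub>C (x::'a::complex_vector))"
  by (induction I rule: infinite_finite_induct) (simp_all add: scaleC_zero_left scaleC_add_left)

lemma cinner_minus_right: "cinner x (- y) = - cinner x (y::'a::complex_hilbert_space)"
  using cinner_scaleC_right[of x "- 1" y] by (simp add: scaleC_minus_one)

lemma cinner_minus_left: "cinner (- x) y = - cinner x (y::'a::complex_hilbert_space)"
  using cinner_scaleC_left[of "- 1" x y] by (simp add: scaleC_minus_one)

lemma cinner_diff_right: "cinner x (y - z) = cinner x y - cinner x (z::'a::complex_hilbert_space)"
  using cinner_add_right[of x y "- z"] by (simp add: cinner_minus_right)

lemma cinner_diff_left: "cinner (x - y) z = cinner x z - cinner y (z::'a::complex_hilbert_space)"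
  using cinner_add_left[of x "- y" z] by (simp add: cinner_minus_left)

lemma cinner_zero_right [simp]: "cinner x 0 = (0::complex)" for x :: "'a::complex_hilbert_space"
  using cinner_diff_right[of x 0 0] by simp

lemma cinner_zero_left [simp]: "cinner 0 x = (0::complex)" for x :: "'a::complex_hilbert_space"
  using cinner_diff_left[of 0 0 x] by simp

lemmas cinner_simps = cinner_add_left cinner_add_right cinner_diff_left cinner_diff_right
  cinner_scaleC_left cinner_scaleC_right cinner_minus_left cinner_minus_right

lemma norm_sq_cinner: "(norm x)\<^sup>2 = Re (cinner x (x::'a::complex_hilbert_space))"
  by (simp add: cinner_norm)

lemma Re_cinner_commute: "Re (cinner x y) = Re (cinner y (x::'a::complex_hilbert_space))"
  using cinner_commute[of x y] by simp

lemma norm_add_sq: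
  "(norm (x + y))\<^sup>2 = (norm x)\<^sup>2 + 2 * Re (cinner x y) + (norm (y::'a::complex_hilbert_space))\<^sup>2"
  using Re_cinner_commute[of x y] by (simp add: norm_sq_cinner cinner_simps)

lemma norm_diff_sq:
  "(norm (x - y))\<^sup>2 = (norm x)\<^sup>2 - 2 * Re (cinner x y) + (norm (y::'a::complex_hilbert_space))\<^sup>2"
  using Re_cinner_commute[of x y] by (simp add: norm_sq_cinner cinner_simps)

text \<open>The hypothesis makes \<open>c *\<^sub>C x\<close> the orthogonal projection of
  \<open>u\<close> onto the line of \<open>x\<close>, so this is Pythagoras. It yields both
  Cauchy-Schwarz and the orthogonality of a minimiser's residual.\<close>

lemma norm_diff_scaleC_sq:
  fixes x u :: "'a::complex_hilbert_space"
  assumes "cinner x u = c * complex_of_real ((norm x)\<^sup>2)"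
  shows "(norm (u - c *\<^sub>C x))\<^sup>2 = (norm u)\<^sup>2 - (cmod c)\<^sup>2 * (norm x)\<^sup>2"
proof -
  have "cinner u (c *\<^sub>C x) = c * cnj (cinner x u)"
    using cinner_commute[of u x] by (simp add: cinner_scaleC_right)
  also have "\<dots> = complex_of_real ((cmod c)\<^sup>2 * (norm x)\<^sup>2)"
    by (simp only: assms) (simp add: mult.assoc[symmetric] flip: complex_norm_square)
  finally show ?thesis
    by (simp add: norm_diff_sq norm_scaleC power_mult_distrib)
qed

lemma cmod_cinner_le: "cmod (cinner x y) \<le> norm x * norm (y::'a::complex_hilbert_space)"
proof (cases "x = 0")
  case False
  define c where "c = cinner x y / complex_of_real ((norm x)\<^sup>2)"
  have "cinner x y = c * complex_of_real ((norm x)\<^sup>2)"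
    using False by (simp add: c_def)
  then have "(cmod c)\<^sup>2 * (norm x)\<^sup>2 \<le> (norm y)\<^sup>2"
    using norm_diff_scaleC_sq[of x y c] by (smt (verit) zero_le_power2)
  then have "(cmod c * norm x)\<^sup>2 \<le> (norm y)\<^sup>2"
    by (simp add: power_mult_distrib)
  then have "cmod c * norm x \<le> norm y"
    by (rule power2_le_imp_le) simp
  then have "norm x * (cmod c * norm x) \<le> norm x * norm y"
    by (rule mult_left_mono) simp
  moreover have "cmod (cinner x y) = cmod c * (norm x)\<^sup>2"
    unfolding \<open>cinner x y = _\<close> by (simp add: norm_mult norm_power)
  ultimately show ?thesis
    by (simp add: power2_eq_square mult_ac)
qed simp

lemma cinner_eqI:
  fixes x y :: "'a::complex_hilbert_space"
  assumes "\<And>z. cinner z x = cinner z y"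
  shows "x = y"
proof -
  have "cinner (x - y) (x - y) = 0"
    using assms[of "x - y"] by (simp add: cinner_diff_right)
  then show ?thesis
    by (simp add: cinner_norm)
qed

text \<open>A sequence in \<open>M\<close> minimising the distance to \<open>x\<close> is Cauchy by
  the parallelogram law. The residual of its limit is orthogonal to \<open>M\<close>, since
  otherwise removing its component along some \<open>y\<close> in \<open>M\<close> would shorten
  it.\<close>

lemma orthogonal_projection:
  fixes M :: "'a::complex_hilbert_space set"
  assumes "closed M" "M \<noteq> {}"
    and add: "\<And>x y. x \<in> M \<Longrightarrow> y \<in> M \<Longrightarrow> x + y \<in> M"
    and scale: "\<And>c x. x \<in> M \<Longrightarrow> c *\<^sub>C x \<in> M"
  obtains m where "m \<in> M" "\<And>y. y \<in> M \<Longrightarrow> cinner y (x - m) = 0"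
proof -
  define D where "D = (INF m\<in>M. (norm (x - m))\<^sup>2)"
  have bdd: "bdd_below ((\<lambda>m. (norm (x - m))\<^sup>2) ` M)"
    by (rule bdd_belowI2[of _ 0]) simp
  have D_le: "D \<le> (norm (x - m))\<^sup>2" if "m \<in> M" for m
    unfolding D_def by (rule cINF_lower[OF bdd that])
  have "\<exists>m\<in>M. (norm (x - m))\<^sup>2 < D + inverse (real (Suc n))" for n
  proof (rule ccontr)
    assume "\<not> ?thesis"
    then have "D + inverse (real (Suc n)) \<le> D"
      unfolding D_def by (intro cINF_greatest[OF \<open>M \<noteq> {}\<close>]) force
    then show False
      by (simp add: field_simps)
  qed
  then obtain f where fM: "\<And>n. f n \<in> M"
    and f: "\<And>n. (norm (x - f n))\<^sup>2 < D + inverse (real (Suc n))"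
    by metis
  have parallelogram: "(norm (f i - f j))\<^sup>2 \<le> 2 * inverse (real (Suc i)) + 2 * inverse (real (Suc j))" for i j
  proof -
    \<comment> \<open>The midpoint stays in \<open>M\<close>, so the sum of the two residuals, being
      twice the residual of the midpoint, has squared norm at least \<open>4 * D\<close>.\<close>
    have mid: "(1/2) *\<^sub>C (f i + f j) \<in> M"
      by (intro scale add fM)
    have "(x - f i) + (x - f j) = 2 *\<^sub>C (x - (1/2) *\<^sub>C (f i + f j))"
      using scaleR_scaleC[of 2 x, symmetric]
      by (simp add: scaleC_diff_right scaleC_scaleC scaleC_one scaleR_2)
    then have "4 * D \<le> (norm ((x - f i) + (x - f j)))\<^sup>2"
      using D_le[OF mid] by (simp add: norm_scaleC power_mult_distrib)
    moreover have "(norm (f i - f j))\<^sup>2 + (norm ((x - f i) + (x - f j)))\<^sup>2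
        = 2 * (norm (x - f i))\<^sup>2 + 2 * (norm (x - f j))\<^sup>2"
      using norm_diff_sq[of "x - f j" "x - f i"] norm_add_sq[of "x - f j" "x - f i"]
      by (simp add: add.commute)
    ultimately show ?thesis
      using f[of i] f[of j] by linarith
  qed
  have "Cauchy f"
  proof (rule metric_CauchyI)
    fix e :: real
    assume "0 < e"
    obtain N where N: "inverse (real (Suc N)) < e\<^sup>2 / 4"
      using reals_Archimedean[of "e\<^sup>2 / 4"] \<open>0 < e\<close> by auto
    have "dist (f i) (f j) < e" if "i \<ge> N" "j \<ge> N" for i j
    proof -
      have "inverse (real (Suc i)) \<le> inverse (real (Suc N))"
        "inverse (real (Suc j)) \<le> inverse (real (Suc N))"
        using that by (simp_all add: field_simps)
      then have "(norm (f i - f j))\<^sup>2 < e\<^sup>2"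
        using parallelogram[of i j] N by linarith
      then show ?thesis
        using \<open>0 < e\<close> by (simp add: dist_norm power2_less_imp_less)
    qed
    then show "\<exists>N. \<forall>i\<ge>N. \<forall>j\<ge>N. dist (f i) (f j) < e"
      by blast
  qed
  then obtain m where m: "f \<longlonglongrightarrow> m"
    using Cauchy_convergent_iff convergent_def by blast
  have mM: "m \<in> M"
    by (rule closed_sequentially[OF \<open>closed M\<close> fM m])
  have "(\<lambda>n. (norm (x - f n))\<^sup>2) \<longlonglongrightarrow> (norm (x - m))\<^sup>2"
    by (intro tendsto_intros m)
  moreover have "(\<lambda>n. D + inverse (real (Suc n))) \<longlonglongrightarrow> D"
    using tendsto_add[OF tendsto_const LIMSEQ_inverse_real_of_nat] by simp
  ultimately have min: "(norm (x - m))\<^sup>2 \<le> D"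
    by (rule LIMSEQ_le) (use f in \<open>force intro: less_imp_le\<close>)
  have "cinner y (x - m) = 0" if "y \<in> M" for y
  proof (cases "y = 0")
    case False
    define c where "c = cinner y (x - m) / complex_of_real ((norm y)\<^sup>2)"
    have c: "cinner y (x - m) = c * complex_of_real ((norm y)\<^sup>2)"
      using False by (simp add: c_def)
    have "m + c *\<^sub>C y \<in> M"
      by (intro add scale mM that)
    then have "D \<le> (norm (x - m - c *\<^sub>C y))\<^sup>2"
      using D_le by (simp add: diff_diff_eq)
    also have "\<dots> = (norm (x - m))\<^sup>2 - (cmod c)\<^sup>2 * (norm y)\<^sup>2"
      by (rule norm_diff_scaleC_sq[OF c])
    finally have "(cmod c)\<^sup>2 * (norm y)\<^sup>2 \<le> 0"
      using min by linarith
    then have "c = 0"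
      using False by (simp add: mult_le_0_iff)
    then show ?thesis
      by (simp add: c)
  qed simp
  with mM show thesis
    by (rule that)
qed

text \<open>For nonzero \<open>f\<close> the kernel has codimension one: subtracting
  \<open>(f y / f v) *\<^sub>C v\<close> moves \<open>y\<close> into it, so a vector
  \<open>v\<close> orthogonal to the kernel represents \<open>f\<close> up to a scalar.\<close>

lemma riesz_representation:
  fixes f :: "'a::complex_hilbert_space \<Rightarrow> complex"
  assumes "bounded_linear f" and hom: "\<And>c x. f (c *\<^sub>C x) = c * f x"
  obtains u where "\<And>y. f y = cinner u y"
proof (cases "\<forall>y. f y = 0")
  case True
  then show thesis
    by (intro that[of 0]) simp
next
  case False
  interpret bounded_linear f by fact
  from False obtain x where x: "f x \<noteq> 0"
    by blast
  have "closed {y. f y = 0}"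
    by (intro closed_Collect_eq continuous_on_const linear_continuous_on assms)
  then obtain m where m: "m \<in> {y. f y = 0}" and orth: "\<And>y. y \<in> {y. f y = 0} \<Longrightarrow> cinner y (x - m) = 0"
  proof (rule orthogonal_projection[of "{y. f y = 0}" x])
    show "{y. f y = 0} \<noteq> {}"
      using zero by blast
  qed (simp_all add: add hom)
  define v where "v = x - m"
  have fv: "f v \<noteq> 0"
    using x m by (simp add: v_def diff)
  then have "v \<noteq> 0"
    using zero by blast
  have eq: "cinner v y = f y / f v * complex_of_real ((norm v)\<^sup>2)" for y
  proof -
    have "cinner (y - (f y / f v) *\<^sub>C v) v = 0"
      by (rule orth[folded v_def]) (use fv in \<open>simp add: diff hom\<close>)
    then have "cinner v (y - (f y / f v) *\<^sub>C v) = 0"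
      by (metis cinner_commute complex_cnj_zero)
    then show ?thesis
      by (simp add: cinner_simps cinner_norm)
  qed
  have "f y = cinner (cnj (f v / complex_of_real ((norm v)\<^sup>2)) *\<^sub>C v) y" for y
    using fv \<open>v \<noteq> 0\<close> by (simp add: cinner_scaleC_left eq)
  then show thesis
    by (rule that)
qed

section \<open>Operators, adjoints and unitaries\<close>

lemma op_apply_plus: "op_apply (S + T) x = op_apply S x + op_apply T x"
  by transfer (simp add: blinfun.add_left)

lemma op_apply_minus: "op_apply (S - T) x = op_apply S x - op_apply T x"
  by transfer (simp add: blinfun.diff_left)

lemma op_apply_zero: "op_apply 0 x = 0"
  by transfer simp

lemma op_apply_scaleC_left: "op_apply (c *\<^sub>C T) x = c *\<^sub>C op_apply T x"
  by transfer (simp add: blinfun_apply_scaleC)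

lemma op_apply_scaleR: "op_apply (r *\<^sub>R T) x = r *\<^sub>R op_apply T x"
  by transfer (simp add: blinfun.scaleR_left)

lemma op_apply_mult: "op_apply (S * T) x = op_apply S (op_apply T x)"
  by transfer simp

lemma op_apply_one: "op_apply 1 x = x"
  by transfer simp

lemmas op_apply_left = op_apply_plus op_apply_minus op_apply_zero op_apply_scaleC_left
  op_apply_scaleR op_apply_mult op_apply_one

lemmas op_apply_add = linear_add[OF bounded_linear.linear[OF bounded_linear_op_apply]]
lemmas op_apply_diff = linear_diff[OF bounded_linear.linear[OF bounded_linear_op_apply]]
lemmas op_apply_sum = linear_sum[OF bounded_linear.linear[OF bounded_linear_op_apply]]
lemmas op_apply_0 = linear_0[OF bounded_linear.linear[OF bounded_linear_op_apply]]

lemma norm_op_apply: "norm (op_apply T x) \<le> norm T * norm x"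
  by transfer (rule norm_blinfun)

lemma norm_op_le: "(\<And>x. norm (op_apply T x) \<le> K * norm x) \<Longrightarrow> 0 \<le> K \<Longrightarrow> norm T \<le> K"
  by transfer (rule norm_blinfun_bound)

lemma op_exists:
  assumes "bounded_linear f" "\<And>c x. f (c *\<^sub>C x) = c *\<^sub>C f x"
  obtains T where "\<And>x. op_apply T x = f (x::'a::complex_hilbert_space)"
proof
  show "op_apply (Bounded_Op (Blinfun f)) x = f x" for x
    using assms by (simp add: op_apply.rep_eq Bounded_Op_inverse bounded_linear_Blinfun_apply)
qed

text \<open>\<open>adjoint_op\<close> is a definite description, so it is evaluated by exhibiting
  one operator with the defining relation; the algebraic rules for adjoints below are obtained this
  way.\<close>

lemma adjoint_op_unique:
  assumes "\<And>x y. cinner (op_apply S x) y = cinner x (op_apply T y)"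
  shows "adjoint_op T = S"
  unfolding adjoint_op_def
proof (rule the_equality)
  fix R assume "\<forall>x y. cinner (op_apply R x) y = cinner x (op_apply T y)"
  then show "R = S"
    using assms by (intro op_eqI cinner_eqI) (metis cinner_commute)
qed (use assms in blast)

text \<open>Riesz representation of \<open>cinner x (op_apply T y)\<close>, as a functional of
  \<open>y\<close>, yields a vector \<open>g x\<close>. Inner products determine vectors, which
  makes \<open>g\<close> linear, and its bound comes from testing with
  \<open>y = g x\<close>.\<close>

lemma adjoint_op_exists: "\<exists>S. \<forall>x y. cinner (op_apply S x) y = cinner x (op_apply T y)"
proof -
  have "\<exists>u. \<forall>y. cinner x (op_apply T y) = cinner u y" for x
  proof -
    have "bounded_linear (\<lambda>y. cinner x (op_apply T y))"
    proof (rule bounded_linear_intro)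
      show "norm (cinner x (op_apply T y)) \<le> norm y * (norm x * norm T)" for y
        using cmod_cinner_le[of x "op_apply T y"] mult_left_mono[OF norm_op_apply[of T y] norm_ge_zero[of x]]
        by (simp add: mult_ac)
    qed (simp_all add: op_apply_add op_apply_scaleC scaleR_scaleC cinner_simps scaleR_conv_of_real)
    then show ?thesis
      by (rule riesz_representation) (auto simp: op_apply_scaleC cinner_simps)
  qed
  then obtain g where g: "\<And>x y. cinner x (op_apply T y) = cinner (g x) y"
    by metis
  have g': "cinner y (g x) = cinner (op_apply T y) x" for x y
    by (metis g cinner_commute)
  have "bounded_linear g"
  proof (rule bounded_linear_intro)
    show "g (x + y) = g x + g y" for x y
      by (rule cinner_eqI) (simp add: g' cinner_simps)
    show "g (r *\<^sub>R x) = r *\<^sub>R g x" for r x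
      by (rule cinner_eqI) (simp add: g' cinner_simps scaleR_scaleC)
    show "norm (g x) \<le> norm x * norm T" for x
    proof (cases "g x = 0")
      case False
      have "complex_of_real ((norm (g x))\<^sup>2) = cinner x (op_apply T (g x))"
        by (simp only: g cinner_norm)
      then have "(norm (g x))\<^sup>2 = cmod (cinner x (op_apply T (g x)))"
        by (metis abs_of_nonneg norm_of_real zero_le_power2)
      also have "\<dots> \<le> norm x * norm (op_apply T (g x))"
        by (rule cmod_cinner_le)
      also have "\<dots> \<le> norm x * (norm T * norm (g x))"
        by (intro mult_left_mono norm_op_apply) simp
      finally show ?thesis
        using False by (simp add: power2_eq_square mult_ac)
    qed simp
  qed
  moreover have "g (c *\<^sub>C x) = c *\<^sub>C g x" for c x
    by (rule cinner_eqI) (simp add: g' cinner_simps)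
  ultimately obtain S where "\<And>x. op_apply S x = g x"
    using op_exists by blast
  then show ?thesis
    using g by (metis)
qed

lemma cinner_adjoint_left: "cinner (op_apply (adjoint_op T) x) y = cinner x (op_apply T y)"
  using adjoint_op_exists[of T] adjoint_op_unique by metis

lemma cinner_adjoint_right: "cinner x (op_apply (adjoint_op T) y) = cinner (op_apply T x) y"
  by (metis cinner_adjoint_left cinner_commute)

lemma adjoint_op_adjoint [simp]: "adjoint_op (adjoint_op T) = T"
  by (rule adjoint_op_unique) (simp add: cinner_adjoint_right)

lemma adjoint_op_mult: "adjoint_op (S * T) = adjoint_op T * adjoint_op S"
  by (rule adjoint_op_unique) (simp add: cinner_adjoint_left op_apply_mult)

lemma adjoint_op_one: "adjoint_op 1 = 1"
  by (rule adjoint_op_unique) (simp add: op_apply_one)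

lemma adjoint_op_plus: "adjoint_op (S + T) = adjoint_op S + adjoint_op T"
  by (rule adjoint_op_unique) (simp add: cinner_adjoint_left op_apply_left cinner_simps)

lemma adjoint_op_scaleC: "adjoint_op (c *\<^sub>C T) = cnj c *\<^sub>C adjoint_op T"
  by (rule adjoint_op_unique) (simp add: cinner_adjoint_left op_apply_left cinner_simps)

lemma adjoint_op_scaleR: "adjoint_op (r *\<^sub>R T) = r *\<^sub>R adjoint_op T"
  by (simp add: scaleR_scaleC adjoint_op_scaleC)

lemma norm_adjoint_op_le: "norm (adjoint_op T) \<le> norm T"
proof (rule norm_op_le)
  fix x
  let ?y = "op_apply (adjoint_op T) x"
  show "norm ?y \<le> norm T * norm x"
  proof (cases "?y = 0")
    case False
    have "complex_of_real ((norm ?y)\<^sup>2) = cinner x (op_apply T ?y)"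
      by (simp only: cinner_norm flip: cinner_adjoint_left)
    then have "(norm ?y)\<^sup>2 = cmod (cinner x (op_apply T ?y))"
      by (metis abs_of_nonneg norm_of_real zero_le_power2)
    also have "\<dots> \<le> norm x * norm (op_apply T ?y)"
      by (rule cmod_cinner_le)
    also have "\<dots> \<le> norm x * (norm T * norm ?y)"
      by (intro mult_left_mono norm_op_apply) simp
    finally show ?thesis
      using False by (simp add: power2_eq_square mult_ac)
  qed simp
qed simp

lemma bounded_linear_adjoint_op: "bounded_linear adjoint_op"
  by (rule bounded_linear_intro[where K = 1])
    (simp_all add: adjoint_op_plus adjoint_op_scaleR norm_adjoint_op_le)

lemma adjoint_op_power: "adjoint_op (T ^ n) = adjoint_op T ^ n"
  by (induction n) (simp_all add: adjoint_op_one adjoint_op_mult power_commutes)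

text \<open>The adjoint is conjugate-linear, but real-linear and continuous; the exponential series
  has real coefficients, so the adjoint may be taken term by term.\<close>

lemma adjoint_op_exp: "adjoint_op (exp T) = exp (adjoint_op T)"
proof -
  have "(\<lambda>n. adjoint_op (T ^ n /\<^sub>R fact n)) sums adjoint_op (exp T)"
    by (intro bounded_linear.sums[OF bounded_linear_adjoint_op] exp_converges)
  then have "(\<lambda>n. adjoint_op T ^ n /\<^sub>R fact n) sums adjoint_op (exp T)"
    by (simp add: adjoint_op_scaleR adjoint_op_power)
  then show ?thesis
    by (rule sums_unique2) (rule exp_converges)
qed

section \<open>Unitary operators\<close>

definition unitary_op :: "'a::nonzero_complex_hilbert_space bounded_op \<Rightarrow> bool"
  where "unitary_op u \<longleftrightarrow> adjoint_op u * u = 1 \<and> u * adjoint_op u = 1"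

lemma unitary_op_adjoint: "unitary_op u \<Longrightarrow> unitary_op (adjoint_op u)"
  by (simp add: unitary_op_def)

lemma unitary_op_mult:
  assumes "unitary_op u" "unitary_op v"
  shows "unitary_op (u * v)"
proof -
  have "adjoint_op v * (adjoint_op u * u) * v = 1" "u * (v * adjoint_op v) * adjoint_op u = 1"
    using assms by (simp_all add: unitary_op_def)
  then show ?thesis
    by (simp add: unitary_op_def adjoint_op_mult mult.assoc)
qed

lemma unitary_op_exp:
  assumes "selfadjoint_op a"
  shows "unitary_op (exp ((\<i> * complex_of_real s) *\<^sub>C a))"
    and "adjoint_op (exp ((\<i> * complex_of_real s) *\<^sub>C a)) = exp (- (\<i> * complex_of_real s) *\<^sub>C a)"
proof -
  have *: "adjoint_op ((\<i> * complex_of_real s) *\<^sub>C a) = - ((\<i> * complex_of_real s) *\<^sub>C a)"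
    using assms by (simp add: adjoint_op_scaleC selfadjoint_op_def scaleC_minus_left)
  show "unitary_op (exp ((\<i> * complex_of_real s) *\<^sub>C a))"
    using exp_minus_inverse[of "- ((\<i> * complex_of_real s) *\<^sub>C a)"]
    by (simp add: unitary_op_def adjoint_op_exp * exp_minus_inverse)
  show "adjoint_op (exp ((\<i> * complex_of_real s) *\<^sub>C a)) = exp (- (\<i> * complex_of_real s) *\<^sub>C a)"
    by (simp add: adjoint_op_exp * scaleC_minus_left)
qed

lemma norm_unitary_apply:
  assumes "unitary_op u"
  shows "norm (op_apply u x) = norm x"
proof -
  have "cinner (op_apply u x) (op_apply u x) = cinner x x"
    using assms by (simp add: unitary_op_def op_apply_one flip: cinner_adjoint_left op_apply_mult)
  then have "(norm (op_apply u x))\<^sup>2 = (norm x)\<^sup>2"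
    by (simp add: norm_sq_cinner)
  then show ?thesis
    by simp
qed

section \<open>The spectrum of a unitary operator\<close>

lemma op_apply_minus_scalar: "op_apply (T - z *\<^sub>C 1) x = op_apply T x - z *\<^sub>C x"
  by (simp add: op_apply_left)

lemma unitary_apply_adjoint:
  assumes "unitary_op w"
  shows "op_apply w (op_apply (adjoint_op w) x) = x" "op_apply (adjoint_op w) (op_apply w x) = x"
  using assms by (simp_all add: unitary_op_def op_apply_one flip: op_apply_mult)

text \<open>The lower bound makes the range of \<open>w - z\<close> closed, so only a nonzero vector
  \<open>u\<close> orthogonal to the range could obstruct invertibility. Such a \<open>u\<close> is
  an eigenvector of the adjoint, and unitarity turns it into an eigenvector of \<open>w\<close>,
  against the lower bound.\<close>

lemma unitary_not_in_spectrum: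
  fixes w :: "'a::nonzero_complex_hilbert_space bounded_op"
  assumes w: "unitary_op w" and "0 < e"
    and below: "\<And>x. e * norm x \<le> norm (op_apply w x - z *\<^sub>C x)"
  shows "z \<notin> spectrum_op w"
proof -
  define T where "T = w - z *\<^sub>C 1"
  have T: "op_apply T x = op_apply w x - z *\<^sub>C x" for x
    by (simp add: T_def op_apply_minus_scalar)
  note belowT = below[folded T]
  have "complete (op_apply T ` UNIV)"
    by (rule complete_isometric_image[OF \<open>0 < e\<close> subspace_UNIV bounded_linear_op_apply _ complete_UNIV])
      (simp add: belowT)
  then have closed: "closed (range (op_apply T))"
    by (rule complete_imp_closed)
  have surj: "\<exists>y. op_apply T y = x" for x
  proof -
    obtain m where m: "m \<in> range (op_apply T)"
      and orth: "\<And>y. y \<in> range (op_apply T) \<Longrightarrow> cinner y (x - m) = 0"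
    proof (rule orthogonal_projection[OF closed, of x])
      show "range (op_apply T) \<noteq> {}"
        by blast
      show "y + y' \<in> range (op_apply T)" if "y \<in> range (op_apply T)" "y' \<in> range (op_apply T)" for y y'
        using that by (auto simp flip: op_apply_add)
      show "c *\<^sub>C y \<in> range (op_apply T)" if "y \<in> range (op_apply T)" for c y
        using that by (auto simp flip: op_apply_scaleC)
    qed (rule that)
    define u where "u = x - m"
    have adj: "op_apply (adjoint_op w) u = cnj z *\<^sub>C u"
    proof (rule cinner_eqI)
      fix y
      have "cinner (op_apply T y) u = 0"
        unfolding u_def by (rule orth) simp
      then show "cinner y (op_apply (adjoint_op w) u) = cinner y (cnj z *\<^sub>C u)"
        by (simp add: T cinner_simps cinner_adjoint_right)
    qed
    have "u = 0"
    proof (rule ccontr)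
      assume "u \<noteq> 0"
      have "norm u = cmod z * norm u"
        using norm_unitary_apply[OF unitary_op_adjoint[OF w], of u] by (simp add: adj norm_scaleC)
      with \<open>u \<noteq> 0\<close> have "cmod z = 1"
        by simp
      \<comment> \<open>Now \<open>cnj z\<close> is the inverse of \<open>z\<close>, so applying
        \<open>w\<close> to the eigenvalue equation of the adjoint shows that \<open>w\<close> maps
        \<open>u\<close> to \<open>z *\<^sub>C u\<close>.\<close>
      then have "z * cnj z = 1"
        by (simp flip: complex_norm_square)
      have "z *\<^sub>C u = z *\<^sub>C op_apply w (cnj z *\<^sub>C u)"
        by (simp add: unitary_apply_adjoint[OF w] flip: adj)
      then have "op_apply T u = 0"
        by (simp add: T op_apply_scaleC scaleC_scaleC \<open>z * cnj z = 1\<close> scaleC_one)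
      then show False
        using belowT[of u] \<open>0 < e\<close> \<open>u \<noteq> 0\<close> by (simp add: mult_le_0_iff)
    qed
    then show ?thesis
      using m by (auto simp: u_def)
  qed
  then obtain g where g: "\<And>x. op_apply T (g x) = x"
    by metis
  have inj: "x = y" if "op_apply T x = op_apply T y" for x y
    using belowT[of "x - y"] that \<open>0 < e\<close> by (simp add: op_apply_diff mult_le_0_iff)
  have "bounded_linear g"
  proof (rule bounded_linear_intro)
    show "g (x + y) = g x + g y" for x y
      by (rule inj) (simp add: g op_apply_add)
    show "g (r *\<^sub>R x) = r *\<^sub>R g x" for r x
      by (rule inj) (simp add: g op_apply_scaleC scaleR_scaleC)
    show "norm (g x) \<le> norm x * (1 / e)" for x
      using belowT[of "g x"] \<open>0 < e\<close> by (simp add: g field_simps)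
  qed
  moreover have "g (c *\<^sub>C x) = c *\<^sub>C g x" for c x
    by (rule inj) (simp add: g op_apply_scaleC)
  ultimately obtain S where S: "\<And>x. op_apply S x = g x"
    using op_exists by blast
  have "S * T = 1" "T * S = 1"
    by (rule op_eqI; simp add: op_apply_left S g inj)+
  then show ?thesis
    unfolding spectrum_op_def T_def by blast
qed

lemma not_in_spectrum_bounded_below:
  assumes "z \<notin> spectrum_op T"
  obtains e where "0 < e" "\<And>x. e * norm x \<le> norm (op_apply T x - z *\<^sub>C x)"
proof -
  obtain S where S: "S * (T - z *\<^sub>C 1) = 1"
    using assms unfolding spectrum_op_def by blast
  \<comment> \<open>The summand 1 makes the denominator positive outright.\<close>
  have "1 / (norm S + 1) * norm x \<le> norm (op_apply T x - z *\<^sub>C x)" for x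
  proof -
    have "x = op_apply S (op_apply T x - z *\<^sub>C x)"
      by (metis S op_apply_minus_scalar op_apply_mult op_apply_one)
    then have "norm x \<le> norm S * norm (op_apply T x - z *\<^sub>C x)"
      by (metis norm_op_apply)
    also have "\<dots> \<le> (norm S + 1) * norm (op_apply T x - z *\<^sub>C x)"
      by (intro mult_right_mono) simp_all
    finally show ?thesis
      by (simp add: pos_divide_le_eq add_nonneg_pos mult.commute)
  qed
  then show thesis
    by (rule that[rotated]) (simp add: add_nonneg_pos)
qed

text \<open>After normalising vectors, the two lemmas above are the two directions. Approximate
  eigenvectors stand in for spectral projections from here on: they give the location and closedness
  of the spectrum and the test vectors of the lower bound.\<close>

lemma unitary_spectrum_iff:
  fixes w :: "'a::nonzero_complex_hilbert_space bounded_op"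
  assumes "unitary_op w"
  shows "z \<in> spectrum_op w \<longleftrightarrow> (\<forall>e>0. \<exists>x. norm x = 1 \<and> norm (op_apply w x - z *\<^sub>C x) < e)"
proof
  assume "\<forall>e>0. \<exists>x. norm x = 1 \<and> norm (op_apply w x - z *\<^sub>C x) < e"
  then show "z \<in> spectrum_op w"
    by (metis linorder_not_less mult.right_neutral not_in_spectrum_bounded_below)
next
  assume z: "z \<in> spectrum_op w"
  show "\<forall>e>0. \<exists>x. norm x = 1 \<and> norm (op_apply w x - z *\<^sub>C x) < e"
  proof (rule ccontr)
    assume "\<not> ?thesis"
    then obtain e where "0 < e"
      and e: "\<And>x. norm x = 1 \<Longrightarrow> e \<le> norm (op_apply w x - z *\<^sub>C x)"
      by force
    have "e * norm x \<le> norm (op_apply w x - z *\<^sub>C x)" for x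
    proof (cases "x = 0")
      case False
      have "op_apply w (complex_of_real (1 / norm x) *\<^sub>C x) - z *\<^sub>C complex_of_real (1 / norm x) *\<^sub>C x
          = complex_of_real (1 / norm x) *\<^sub>C (op_apply w x - z *\<^sub>C x)"
        by (simp add: op_apply_scaleC scaleC_diff_right scaleC_left_commute[of z])
      moreover have "norm (complex_of_real (1 / norm x) *\<^sub>C x) = 1"
        using False by (simp add: norm_scaleC norm_divide)
      ultimately have "e \<le> norm (complex_of_real (1 / norm x) *\<^sub>C (op_apply w x - z *\<^sub>C x))"
        using e[of "complex_of_real (1 / norm x) *\<^sub>C x"] by simp
      also have "\<dots> = norm (op_apply w x - z *\<^sub>C x) / norm x"
        by (simp add: norm_scaleC norm_divide)
      finally show ?thesis
        using False by (simp add: field_simps)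
    qed (simp add: op_apply_0)
    with z show False
      using unitary_not_in_spectrum[OF assms \<open>0 < e\<close>] by blast
  qed
qed

lemma unitary_spectrum_circle:
  assumes "unitary_op w" "z \<in> spectrum_op w"
  shows "cmod z = 1"
proof -
  have "\<bar>1 - cmod z\<bar> \<le> 0 + e" if "0 < e" for e
  proof -
    obtain x where x: "norm x = 1" "norm (op_apply w x - z *\<^sub>C x) < e"
      using assms unitary_spectrum_iff \<open>0 < e\<close> by metis
    have "\<bar>norm (op_apply w x) - norm (z *\<^sub>C x)\<bar> \<le> norm (op_apply w x - z *\<^sub>C x)"
      by (rule norm_triangle_ineq3)
    then show ?thesis
      using x by (simp add: norm_unitary_apply[OF assms(1)] norm_scaleC)
  qed
  then have "\<bar>1 - cmod z\<bar> \<le> 0"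
    by (rule field_le_epsilon)
  then show ?thesis
    by simp
qed

lemma unitary_spectrum_compact:
  assumes w: "unitary_op w"
  shows "compact (spectrum_op w)"
proof -
  have "z \<in> spectrum_op w" if z: "z \<in> closure (spectrum_op w)" for z
    unfolding unitary_spectrum_iff[OF w]
  proof (intro allI impI)
    fix e :: real
    assume "0 < e"
    then obtain y where y: "y \<in> spectrum_op w" "dist y z < e / 2"
      using z by (metis closure_approachable half_gt_zero)
    then obtain x where x: "norm x = 1" "norm (op_apply w x - y *\<^sub>C x) < e / 2"
      using unitary_spectrum_iff[OF w] \<open>0 < e\<close> by (metis half_gt_zero)
    have "op_apply w x - z *\<^sub>C x = (op_apply w x - y *\<^sub>C x) + (y - z) *\<^sub>C x"
      by (simp add: scaleC_diff_left)
    then have "norm (op_apply w x - z *\<^sub>C x) \<le> norm (op_apply w x - y *\<^sub>C x) + norm ((y - z) *\<^sub>C x)"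
      by (metis norm_triangle_ineq)
    then have "norm (op_apply w x - z *\<^sub>C x) < e"
      using x y by (simp add: norm_scaleC dist_norm)
    with x show "\<exists>x. norm x = 1 \<and> norm (op_apply w x - z *\<^sub>C x) < e"
      by blast
  qed
  then have "closed (spectrum_op w)"
    by (metis closure_subset closure_eq subsetI subset_antisym)
  moreover have "bounded (spectrum_op w)"
    unfolding bounded_iff using unitary_spectrum_circle[OF w] by (metis order_refl)
  ultimately show ?thesis
    by (simp add: compact_eq_bounded_closed)
qed

text \<open>A minimising sequence for the form of \<open>h = Re (cnj d w)\<close> with infimum \<open>m\<close> is annihilated by
  \<open>h - m\<close> in the limit.  Since \<open>h - m\<close> is \<open>w\<^sup>*\<close> times a quadratic polynomial in \<open>w\<close>, one of the roots
  of this polynomial lies in the spectrum.\<close>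

lemma unitary_numerical_range_support:
  fixes w :: "'a::nonzero_complex_hilbert_space bounded_op"
  assumes w: "unitary_op w" and d: "d \<noteq> 0"
  obtains \<mu> where "\<mu> \<in> spectrum_op w"
    "\<And>x. norm x = 1 \<Longrightarrow> Re (cnj d * \<mu>) \<le> Re (cnj d * cinner x (op_apply w x))"
proof -
  define q where "q x = Re (cnj d * cinner x (op_apply w x))" for x
  define m where "m = (INF x\<in>{x. norm x = 1}. q x)"
  obtain x0 :: 'a where x0: "norm x0 = 1"
  proof -
    obtain y :: 'a where "y \<noteq> 0"
      using ex_nonzero by blast
    then have "norm (y /\<^sub>R norm y) = 1"
      by simp
    then show thesis
      by (rule that)
  qed
  have "- cmod d \<le> q x" if "norm x = 1" for x
  proof -
    have "\<bar>q x\<bar> \<le> cmod d * cmod (cinner x (op_apply w x))"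
      unfolding q_def by (metis abs_Re_le_cmod complex_mod_cnj norm_mult)
    also have "\<dots> \<le> cmod d * 1"
      using cmod_cinner_le[of x "op_apply w x"] that
      by (intro mult_left_mono) (simp_all add: norm_unitary_apply[OF w])
    finally show ?thesis
      by simp
  qed
  then have bdd: "bdd_below (q ` {x. norm x = 1})"
    by (intro bdd_belowI2[of _ "- cmod d"]) simp
  have m_le: "m \<le> q x" if "norm x = 1" for x
    unfolding m_def using that by (intro cINF_lower[OF bdd]) simp
  have m_scaled: "m * (norm x)\<^sup>2 \<le> q x" for x
  proof (cases "x = 0")
    case False
    define r where "r = 1 / norm x"
    have "norm (complex_of_real r *\<^sub>C x) = 1"
      using False by (simp add: norm_scaleC r_def norm_divide)
    then have "m \<le> q (complex_of_real r *\<^sub>C x)"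
      by (rule m_le)
    also have "\<dots> = r\<^sup>2 * q x"
      by (simp add: q_def op_apply_scaleC cinner_simps power2_eq_square algebra_simps)
    finally show ?thesis
      using False by (simp add: r_def field_simps)
  qed (simp add: q_def)
  \<comment> \<open>\<open>P\<close> is the selfadjoint operator \<open>h - m\<close>; the choice of
    \<open>m\<close> makes its quadratic form nonnegative.\<close>
  define P where "P = (1/2) *\<^sub>C (cnj d *\<^sub>C w + d *\<^sub>C adjoint_op w) - complex_of_real m *\<^sub>C 1"
  have P: "op_apply P x = (1/2) *\<^sub>C (cnj d *\<^sub>C op_apply w x + d *\<^sub>C op_apply (adjoint_op w) x)
      - complex_of_real m *\<^sub>C x" for x
    by (simp add: P_def op_apply_left)
  have P_sym: "cinner (op_apply P x) y = cinner x (op_apply P y)" for x y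
    by (simp add: P cinner_simps cinner_adjoint_left cinner_adjoint_right algebra_simps)
  have P_form: "Re (cinner x (op_apply P x)) = q x - m * (norm x)\<^sup>2" for x
  proof -
    have "cinner (op_apply w x) x = cnj (cinner x (op_apply w x))"
      by (rule cinner_commute)
    then show ?thesis
      by (simp add: P cinner_simps cinner_adjoint_right q_def cinner_norm algebra_simps
          flip: of_real_power)
  qed
  define K where "K = norm P + 1"
  have "0 < K"
    by (simp add: K_def add_nonneg_pos)
  \<comment> \<open>For a positive operator a small value of the form forces a small image. The
    inequality is positivity tested at \<open>K x - P x\<close>, where \<open>K\<close> bounds
    \<open>norm P\<close> and is positive.\<close>
  have P_le: "(norm (op_apply P x))\<^sup>2 \<le> K * (q x - m * (norm x)\<^sup>2)" for x
  proof -
    define y where "y = op_apply P x"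
    have "Re (cinner y (op_apply P y)) \<le> norm y * norm (op_apply P y)"
      using cmod_cinner_le complex_Re_le_cmod order_trans by blast
    also have "\<dots> \<le> norm y * (K * norm y)"
    proof (rule mult_left_mono)
      show "norm (op_apply P y) \<le> K * norm y"
        using norm_op_apply[of P y] by (simp add: K_def distrib_right add_increasing2)
    qed simp
    finally have bound: "Re (cinner y (op_apply P y)) \<le> K * (norm y)\<^sup>2"
      by (simp add: power2_eq_square mult_ac)
    have "0 \<le> Re (cinner (complex_of_real K *\<^sub>C x - y) (op_apply P (complex_of_real K *\<^sub>C x - y)))"
      using m_scaled by (simp add: P_form)
    also have "\<dots> = K\<^sup>2 * Re (cinner x y) - K * Re (cinner x (op_apply P y))
        - K * Re (cinner y y) + Re (cinner y (op_apply P y))"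
      by (simp add: op_apply_diff op_apply_scaleC cinner_simps power2_eq_square flip: y_def)
        (simp add: algebra_simps)
    also have "cinner x (op_apply P y) = cinner y y"
      unfolding y_def by (rule P_sym[symmetric])
    finally have "K * (norm y)\<^sup>2 \<le> K * (K * Re (cinner x y))"
      using bound by (simp add: norm_sq_cinner[symmetric] power2_eq_square algebra_simps)
    then show ?thesis
      using \<open>0 < K\<close> by (simp add: y_def P_form)
  qed
  \<comment> \<open>The roots \<open>\<alpha>\<close> and \<open>\<beta>\<close> belong to the
    polynomial \<open>cnj d * z\<^sup>2 - 2 * m * z + d\<close>, which arises from multiplying
    \<open>h - m\<close> by \<open>2 w\<close>. Its discriminant may be negative, hence
    \<open>csqrt\<close>.\<close>
  define r where "r = csqrt (complex_of_real (m\<^sup>2 - (cmod d)\<^sup>2))"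
  have r: "r\<^sup>2 = (complex_of_real m)\<^sup>2 - d * cnj d"
    using complex_norm_square[of d] by (simp add: r_def)
  define \<alpha> where "\<alpha> = (complex_of_real m + r) / cnj d"
  define \<beta> where "\<beta> = (complex_of_real m - r) / cnj d"
  have sum: "cnj d * (\<alpha> + \<beta>) = 2 * complex_of_real m" and prod: "cnj d * (\<alpha> * \<beta>) = d"
  proof -
    show "cnj d * (\<alpha> + \<beta>) = 2 * complex_of_real m"
      using d by (simp add: \<alpha>_def \<beta>_def field_simps)
    have "(complex_of_real m + r) * (complex_of_real m - r) = d * cnj d"
      using r by (simp add: algebra_simps power2_eq_square)
    then show "cnj d * (\<alpha> * \<beta>) = d"
      using d by (simp add: \<alpha>_def \<beta>_def)
  qed
  have factor: "op_apply P x = (cnj d / 2) *\<^sub>C op_apply (adjoint_op w)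
      (op_apply w (op_apply w x - \<beta> *\<^sub>C x) - \<alpha> *\<^sub>C (op_apply w x - \<beta> *\<^sub>C x))" for x
  proof -
    have eq: "op_apply w (op_apply w x - \<beta> *\<^sub>C x) - \<alpha> *\<^sub>C (op_apply w x - \<beta> *\<^sub>C x)
        = op_apply w (op_apply w x) - (\<alpha> + \<beta>) *\<^sub>C op_apply w x + (\<alpha> * \<beta>) *\<^sub>C x"
      by (simp add: op_apply_diff op_apply_scaleC scaleC_diff_right scaleC_scaleC scaleC_add_left)
    have "(cnj d / 2) *\<^sub>C op_apply (adjoint_op w)
        (op_apply w (op_apply w x - \<beta> *\<^sub>C x) - \<alpha> *\<^sub>C (op_apply w x - \<beta> *\<^sub>C x))
        = (cnj d / 2) *\<^sub>C op_apply w x - ((cnj d * (\<alpha> + \<beta>)) / 2) *\<^sub>C x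
          + ((cnj d * (\<alpha> * \<beta>)) / 2) *\<^sub>C op_apply (adjoint_op w) x"
      unfolding eq
      by (simp add: op_apply_diff op_apply_add op_apply_scaleC scaleC_diff_right scaleC_add_right
          scaleC_scaleC unitary_apply_adjoint[OF w])
    then show ?thesis
      by (simp add: sum prod P scaleC_add_right scaleC_scaleC)
  qed
  have "\<alpha> \<in> spectrum_op w \<or> \<beta> \<in> spectrum_op w"
  proof (rule ccontr)
    assume neither: "\<not> ?thesis"
    obtain e where e: "0 < e" "\<And>x. e * norm x \<le> norm (op_apply w x - \<alpha> *\<^sub>C x)"
      using neither not_in_spectrum_bounded_below by blast
    obtain e' where e': "0 < e'" "\<And>x. e' * norm x \<le> norm (op_apply w x - \<beta> *\<^sub>C x)"
      using neither not_in_spectrum_bounded_below by blast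
    \<comment> \<open>With neither root in the spectrum, both linear factors of \<open>P\<close> are
      bounded below. Then \<open>P\<close> is bounded below by \<open>\<delta>\<close> on unit
      vectors, and \<open>P_le\<close> keeps the form of \<open>h\<close> at least
      \<open>\<delta>\<^sup>2 / K\<close> above its infimum.\<close>
    define \<delta> where "\<delta> = cmod d / 2 * (e * e')"
    have "0 < \<delta>"
      using d e e' by (simp add: \<delta>_def)
    have below: "\<delta> \<le> norm (op_apply P x)" if "norm x = 1" for x
    proof -
      have "e * e' \<le> e * norm (op_apply w x - \<beta> *\<^sub>C x)"
        using e'(2)[of x] e(1) that by simp
      also have "\<dots> \<le> norm (op_apply w (op_apply w x - \<beta> *\<^sub>C x) - \<alpha> *\<^sub>C (op_apply w x - \<beta> *\<^sub>C x))"
        by (rule e(2))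
      finally show ?thesis
        unfolding \<delta>_def factor
        by (simp add: norm_scaleC norm_unitary_apply[OF unitary_op_adjoint[OF w]] norm_divide
            mult_left_mono)
    qed
    have "m + \<delta>\<^sup>2 / K \<le> q x" if "norm x = 1" for x
    proof -
      have "\<delta>\<^sup>2 \<le> K * (q x - m)"
        using order_trans[OF power_mono[OF below[OF that], of 2] P_le[of x]] that \<open>0 < \<delta>\<close> by simp
      then show ?thesis
        using \<open>0 < K\<close> by (simp add: field_simps)
    qed
    then have "m + \<delta>\<^sup>2 / K \<le> m"
      unfolding m_def using x0 by (intro cINF_greatest) auto
    then show False
      using \<open>0 < K\<close> \<open>0 < \<delta>\<close> by (simp add: divide_le_0_iff)
  qed
  then obtain \<mu> where \<mu>: "\<mu> \<in> spectrum_op w" and "\<mu> = \<alpha> \<or> \<mu> = \<beta>"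
    by blast
  then have "(\<mu> - \<alpha>) * (\<mu> - \<beta>) = 0"
    by auto
  then have "cnj d * ((\<mu> - \<alpha>) * (\<mu> - \<beta>)) = 0"
    by simp
  then have root: "cnj d * \<mu>\<^sup>2 - cnj d * (\<alpha> + \<beta>) * \<mu> + cnj d * (\<alpha> * \<beta>) = 0"
    by (simp add: algebra_simps power2_eq_square)
  have unit: "\<mu> * cnj \<mu> = 1"
    using unitary_spectrum_circle[OF w \<mu>] by (simp flip: complex_norm_square)
  \<comment> \<open>Multiplying the quadratic equation by \<open>cnj \<mu>\<close>, the inverse of
    \<open>\<mu>\<close>, turns it into \<open>2 * Re (cnj d * \<mu>) = 2 * m\<close>.\<close>
  have "cnj d * \<mu> + cnj (cnj d * \<mu>) = cnj \<mu> * (cnj d * \<mu>\<^sup>2 + d) + cnj d * \<mu> * (1 - \<mu> * cnj \<mu>)"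
    by (simp add: algebra_simps power2_eq_square)
  also have "cnj d * \<mu>\<^sup>2 + d = 2 * complex_of_real m * \<mu>"
    using root unfolding sum prod by (simp add: algebra_simps)
  finally have "cnj d * \<mu> + cnj (cnj d * \<mu>) = 2 * complex_of_real m * (\<mu> * cnj \<mu>)"
    by (simp add: unit mult_ac)
  then have "Re (cnj d * \<mu> + cnj (cnj d * \<mu>)) = 2 * m"
    by (simp add: unit)
  then have m: "Re (cnj d * \<mu>) = m"
    by (simp add: algebra_simps)
  show thesis
    by (rule that[OF \<mu>]) (use m_le in \<open>simp only: m q_def\<close>)
qed

text \<open>The support lemma in the direction 1 already produces a spectral value.\<close>

lemma unitary_spectrum_nonempty: "unitary_op w \<Longrightarrow> spectrum_op w \<noteq> {}"
  by (metis empty_iff one_neq_zero unitary_numerical_range_support)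

section \<open>Subsets of the unit circle\<close>

text \<open>This is the variational inequality at the point of the hull nearest to 0: for nonzero
  \<open>c\<close> the set lies beyond the line through \<open>c\<close> perpendicular to
  \<open>c\<close>.\<close>

lemma infdist_convex_hull_support:
  fixes S :: "complex set"
  assumes "compact S" "S \<noteq> {}"
  obtains c where "c \<in> convex hull S" "cmod c = infdist 0 (convex hull S)"
    "\<And>z. z \<in> S \<Longrightarrow> (cmod c)\<^sup>2 \<le> Re (cnj c * z)"
proof -
  have closed: "closed (convex hull S)"
    using assms by (simp add: compact_convex_hull compact_imp_closed)
  have "convex hull S \<noteq> {}"
    using assms by simp
  then obtain c where c: "c \<in> convex hull S" "infdist 0 (convex hull S) = dist 0 c"
    using infdist_attains_inf[OF closed] by metis
  have "(cmod c)\<^sup>2 \<le> Re (cnj c * z)" if "z \<in> S" for z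
  proof -
    have "inner (0 - c) (z - c) \<le> 0"
    proof (rule any_closest_point_dot)
      show "\<forall>z\<in>convex hull S. dist 0 c \<le> dist 0 z"
        using c(2) infdist_le by metis
    qed (use closed c that hull_subset in \<open>auto simp: convex_convex_hull hull_inc\<close>)
    then show ?thesis
      by (simp add: inner_complex_def cmod_def algebra_simps power2_eq_square)
  qed
  with c show thesis
    by (intro that) simp_all
qed

text \<open>Short arcs correspond to half-planes. An arc of length \<open>l \<le> pi\<close> lies
  beyond its chord, whose distance from 0 is \<open>cos (l / 2)\<close>; conversely, for nonzero
  \<open>c\<close> the supporting half-plane at the nearest point \<open>c\<close> meets the circle
  in an arc of length \<open>2 * arccos (cmod c)\<close>. Hence \<open>min \<Theta> pi\<close> is
  this length.\<close>

lemma sqrt_infdist_eq_sin_arc: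
  fixes S :: "complex set"
  assumes compact: "compact S" and ne: "S \<noteq> {}" and circle: "\<And>z. z \<in> S \<Longrightarrow> cmod z = 1"
  defines "\<Theta> \<equiv> Inf {l. 0 \<le> l \<and> l \<le> 2 * pi \<and> (\<exists>\<alpha>. S \<subseteq> cis ` {\<alpha>..\<alpha> + l})}"
  shows "sqrt (1 - (infdist 0 (convex hull S))\<^sup>2) = sin (1/2 * min \<Theta> pi)"
proof -
  define L where "L = {l. 0 \<le> l \<and> l \<le> 2 * pi \<and> (\<exists>\<alpha>. S \<subseteq> cis ` {\<alpha>..\<alpha> + l})}"
  have \<Theta>: "\<Theta> = Inf L"
    by (simp add: \<Theta>_def L_def)
  obtain c where c: "c \<in> convex hull S" and \<nu>: "cmod c = infdist 0 (convex hull S)"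
    and support: "\<And>z. z \<in> S \<Longrightarrow> (cmod c)\<^sup>2 \<le> Re (cnj c * z)"
    using infdist_convex_hull_support[OF compact ne] by metis
  have "convex hull S \<subseteq> cball 0 1"
    using circle by (intro hull_minimal convex_cball) auto
  with c have c1: "cmod c \<le> 1"
    by auto
  have bdd: "bdd_below L"
    by (rule bdd_belowI[of _ 0]) (simp add: L_def)
  have "z = cis (Arg2pi z)" if "z \<in> S" for z
    using Arg2pi_eq[of z] circle[OF that] by (simp add: cis_conv_exp)
  then have "S \<subseteq> cis ` {0..0 + 2 * pi}"
    using Arg2pi_ge_0 Arg2pi_lt_2pi by (force simp: image_iff intro: less_imp_le)
  \<comment> \<open>The full circle is admissible, so the infimum runs over a nonempty set.\<close>
  then have "2 * pi \<in> L"
    by (auto simp: L_def simp del: add_0)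
  then have "L \<noteq> {}"
    by blast
  have lower: "2 * arccos (cmod c) \<le> l" if l: "l \<in> L" for l
  proof (cases "l \<le> pi")
    case True
    obtain \<alpha> where "0 \<le> l" and \<alpha>: "S \<subseteq> cis ` {\<alpha>..\<alpha> + l}"
      using l by (auto simp: L_def)
    have "S \<subseteq> {z. inner (cis (\<alpha> + l / 2)) z \<ge> cos (l / 2)}"
    proof
      fix z
      assume "z \<in> S"
      then have "z \<in> cis ` {\<alpha>..\<alpha> + l}"
        using \<alpha> by blast
      then obtain \<theta> where \<theta>: "\<alpha> \<le> \<theta>" "\<theta> \<le> \<alpha> + l" "z = cis \<theta>"
        by (auto elim!: imageE)
      \<comment> \<open>The absolute value puts the angle to the midpoint of the arc into [0, pi],
        where the cosine decreases.\<close>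
      have "inner (cis (\<alpha> + l / 2)) z = cos \<bar>\<theta> - (\<alpha> + l / 2)\<bar>"
        by (simp add: \<theta>(3) inner_complex_def cos_diff)
      moreover have "cos (l / 2) \<le> cos \<bar>\<theta> - (\<alpha> + l / 2)\<bar>"
        using \<theta> True \<open>0 \<le> l\<close> by (intro cos_monotone_0_pi_le) (auto simp: abs_if)
      ultimately show "z \<in> {z. inner (cis (\<alpha> + l / 2)) z \<ge> cos (l / 2)}"
        by simp
    qed
    then have "convex hull S \<subseteq> {z. inner (cis (\<alpha> + l / 2)) z \<ge> cos (l / 2)}"
      by (intro hull_minimal convex_halfspace_ge)
    with c have "cos (l / 2) \<le> inner (cis (\<alpha> + l / 2)) c"
      by auto
    also have "\<dots> \<le> cmod (cis (\<alpha> + l / 2)) * cmod c"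
      by (rule norm_cauchy_schwarz)
    finally have "cos (l / 2) \<le> cmod c"
      by simp
    then have "arccos (cmod c) \<le> arccos (cos (l / 2))"
      using c1 by (intro arccos_le_arccos) simp_all
    also have "\<dots> = l / 2"
      using True \<open>0 \<le> l\<close> by (intro arccos_cos) simp_all
    finally show ?thesis
      by simp
  next
    case False
    \<comment> \<open>An arc longer than pi gives no information on \<open>c\<close>, but
      \<open>2 * arccos\<close> of a nonnegative number is at most pi.\<close>
    have "arccos (cmod c) \<le> arccos 0"
      using c1 by (intro arccos_le_arccos) simp_all
    with False show ?thesis
      by (simp add: arccos_0)
  qed
  have half: "arccos (cmod c) \<le> pi / 2"
    using arccos_le_arccos[of 0 "cmod c"] c1 by (simp add: arccos_0)
  have "min \<Theta> pi = 2 * arccos (cmod c)"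
  proof (rule antisym)
    have "2 * arccos (cmod c) \<le> \<Theta>"
      unfolding \<Theta> using \<open>L \<noteq> {}\<close> lower by (rule cInf_greatest)
    with half show "2 * arccos (cmod c) \<le> min \<Theta> pi"
      by simp
    show "min \<Theta> pi \<le> 2 * arccos (cmod c)"
    proof (cases "c = 0")
      case False
      define \<gamma> where "\<gamma> = Arg c"
      have "S \<subseteq> cis ` {\<gamma> - arccos (cmod c)..\<gamma> - arccos (cmod c) + 2 * arccos (cmod c)}"
      proof
        fix z
        assume "z \<in> S"
        define \<theta> where "\<theta> = Arg (z / cis \<gamma>)"
        have "cmod (z / cis \<gamma>) = 1"
          using circle[OF \<open>z \<in> S\<close>] by (simp add: norm_divide)
        then have "cis \<theta> = z / cis \<gamma>"
          unfolding \<theta>_def by (metis cis_Arg div_by_1 norm_eq_zero of_real_1 sgn_eq zero_neq_one)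
        then have z: "z = cis (\<gamma> + \<theta>)"
          by (simp add: cis_mult[symmetric])
        have "c = complex_of_real (cmod c) * cis \<gamma>"
          unfolding \<gamma>_def by (simp add: rcis_cmod_Arg flip: rcis_def)
        then have "Re (cnj c * z) = Re (cnj (complex_of_real (cmod c) * cis \<gamma>) * z)"
          by simp
        also have "\<dots> = cmod c * cos \<theta>"
          by (simp add: z cis_cnj cis_mult mult.assoc)
        finally have "cmod c * cmod c \<le> cmod c * cos \<theta>"
          using support[OF \<open>z \<in> S\<close>] by (simp add: power2_eq_square)
        then have "cmod c \<le> cos \<bar>\<theta>\<bar>"
          using False by simp
        then have "arccos (cos \<bar>\<theta>\<bar>) \<le> arccos (cmod c)"
          by (intro arccos_le_arccos) (auto intro: order_trans[of _ 0])
        moreover have "arccos (cos \<bar>\<theta>\<bar>) = \<bar>\<theta>\<bar>"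
          using Arg_bounded[of "z / cis \<gamma>"] by (intro arccos_cos) (auto simp: \<theta>_def)
        ultimately have "\<bar>\<theta>\<bar> \<le> arccos (cmod c)"
          by simp
        then show "z \<in> cis ` {\<gamma> - arccos (cmod c)..\<gamma> - arccos (cmod c) + 2 * arccos (cmod c)}"
          unfolding z by (intro imageI) auto
      qed
      moreover have "0 \<le> arccos (cmod c)"
        using c1 by (intro arccos_lbound) (auto intro: order_trans[of _ 0])
      ultimately have "2 * arccos (cmod c) \<in> L"
        using half unfolding L_def by (intro CollectI conjI exI[of _ "\<gamma> - arccos (cmod c)"]) auto
      then have "\<Theta> \<le> 2 * arccos (cmod c)"
        unfolding \<Theta> by (intro cInf_lower bdd)
      then show ?thesis
        by simp
    \<comment> \<open>For \<open>c = 0\<close> there is no supporting direction; the bound is then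
      the cap, because \<open>2 * arccos 0 = pi\<close>.\<close>
    qed (simp add: arccos_0)
  qed
  then have "sin (1/2 * min \<Theta> pi) = sin (arccos (cmod c))"
    by simp
  also have "\<dots> = sqrt (1 - (cmod c)\<^sup>2)"
    using c1 by (intro sin_arccos) (auto intro: order_trans[of _ 0])
  finally show ?thesis
    by (simp add: \<nu>)
qed

section \<open>Completely bounded norms\<close>

text \<open>A real-valued \<open>SUP\<close> dominates its members only if they are bounded above;
  the sum of the norms of all entries is a crude bound.\<close>

lemma bdd_above_matrix_norm:
  fixes A :: "nat \<Rightarrow> nat \<Rightarrow> 'a::complex_hilbert_space bounded_op"
  shows "bdd_above ((\<lambda>x. L2_set (\<lambda>i. norm (\<Sum>j<n. op_apply (A i j) (x j))) {..<n}) `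
    {x. L2_set (\<lambda>j. norm (x j)) {..<n} \<le> 1})"
proof (rule bdd_aboveI2)
  fix x :: "nat \<Rightarrow> 'a"
  assume x: "x \<in> {x. L2_set (\<lambda>j. norm (x j)) {..<n} \<le> 1}"
  have x1: "norm (x j) \<le> 1" if "j < n" for j
    using member_le_L2_set[of "{..<n}" j "\<lambda>j. norm (x j)"] x that by simp
  have "norm (\<Sum>j<n. op_apply (A i j) (x j)) \<le> (\<Sum>j<n. norm (A i j))" for i
  proof (rule sum_norm_le)
    fix j
    assume "j \<in> {..<n}"
    then have "norm (A i j) * norm (x j) \<le> norm (A i j) * 1"
      by (intro mult_left_mono x1) simp_all
    then show "norm (op_apply (A i j) (x j)) \<le> norm (A i j)"
      using norm_op_apply[of "A i j" "x j"] by simp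
  qed
  then have sum: "(\<Sum>i<n. norm (\<Sum>j<n. op_apply (A i j) (x j))) \<le> (\<Sum>i<n. \<Sum>j<n. norm (A i j))"
    by (rule sum_mono)
  show "L2_set (\<lambda>i. norm (\<Sum>j<n. op_apply (A i j) (x j))) {..<n} \<le> (\<Sum>i<n. \<Sum>j<n. norm (A i j))"
    by (rule order_trans[OF L2_set_le_sum sum]) simp
qed

lemma matrix_norm_le:
  fixes A :: "nat \<Rightarrow> nat \<Rightarrow> 'a::complex_hilbert_space bounded_op"
  assumes "\<And>x. L2_set (\<lambda>j. norm (x j)) {..<n} \<le> 1 \<Longrightarrow>
    L2_set (\<lambda>i. norm (\<Sum>j<n. op_apply (A i j) (x j))) {..<n} \<le> K"
  shows "matrix_norm n A \<le> K"
  unfolding matrix_norm_def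
proof (rule cSUP_least)
  have "L2_set (\<lambda>j. norm (0::'a)) {..<n} \<le> 1"
    by (simp add: L2_set_def)
  then show "{x :: nat \<Rightarrow> 'a. L2_set (\<lambda>j. norm (x j)) {..<n} \<le> 1} \<noteq> {}"
    by (auto intro!: exI[of _ "\<lambda>_. 0"])
qed (use assms in simp)

lemma le_matrix_norm:
  assumes "L2_set (\<lambda>j. norm (x j)) {..<n} \<le> 1"
  shows "L2_set (\<lambda>i. norm (\<Sum>j<n. op_apply (A i j) (x j))) {..<n} \<le> matrix_norm n A"
  unfolding matrix_norm_def using assms by (intro cSUP_upper bdd_above_matrix_norm) simp

lemma matrix_norm_apply:
  "L2_set (\<lambda>i. norm (\<Sum>j<n. op_apply (A i j) (x j))) {..<n}
    \<le> matrix_norm n A * L2_set (\<lambda>j. norm (x j)) {..<n}"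
proof (cases "L2_set (\<lambda>j. norm (x j)) {..<n} = 0")
  case True
  then have "x j = 0" if "j < n" for j
    using that by (simp add: L2_set_eq_0_iff)
  then have "(\<Sum>j<n. op_apply (A i j) (x j)) = 0" for i
    by (simp add: op_apply_0)
  then show ?thesis
    using True by (simp add: L2_set_def)
next
  case False
  define l where "l = L2_set (\<lambda>j. norm (x j)) {..<n}"
  have "0 < l"
    using False L2_set_nonneg[of "\<lambda>j. norm (x j)" "{..<n}"] unfolding l_def by linarith
  define y where "y j = complex_of_real (1 / l) *\<^sub>C x j" for j
  have "L2_set (\<lambda>j. norm (y j)) {..<n} = 1 / l * l"
    unfolding y_def l_def by (subst L2_set_right_distrib) (simp_all add: norm_scaleC norm_divide L2_set_nonneg)
  then have "L2_set (\<lambda>i. norm (\<Sum>j<n. op_apply (A i j) (y j))) {..<n} \<le> matrix_norm n A"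
    using \<open>0 < l\<close> by (intro le_matrix_norm) simp
  moreover have "norm (\<Sum>j<n. op_apply (A i j) (y j)) = 1 / l * norm (\<Sum>j<n. op_apply (A i j) (x j))" for i
    unfolding y_def op_apply_scaleC scaleC_sum_right[symmetric]
    using \<open>0 < l\<close> by (simp add: norm_scaleC norm_divide)
  ultimately have "1 / l * L2_set (\<lambda>i. norm (\<Sum>j<n. op_apply (A i j) (x j))) {..<n} \<le> matrix_norm n A"
    using \<open>0 < l\<close> by (subst L2_set_right_distrib) simp_all
  then show ?thesis
    using \<open>0 < l\<close> by (simp add: field_simps flip: l_def)
qed

lemma cb_norm_le:
  fixes \<Phi> :: "'a::complex_hilbert_space bounded_op \<Rightarrow> 'a bounded_op"
  assumes "\<And>n A x. matrix_norm n A \<le> 1 \<Longrightarrow> L2_set (\<lambda>j. norm (x j)) {..<n} \<le> 1 \<Longrightarrow>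
    L2_set (\<lambda>i. norm (\<Sum>j<n. op_apply (\<Phi> (A i j)) (x j))) {..<n} \<le> K"
  shows "cb_norm \<Phi> \<le> ereal K"
  unfolding cb_norm_def
proof (intro SUP_least)
  fix n and A :: "nat \<Rightarrow> nat \<Rightarrow> 'a bounded_op"
  assume "A \<in> {A. matrix_norm n A \<le> 1}"
  then show "ereal (matrix_norm n (\<lambda>i j. \<Phi> (A i j))) \<le> ereal K"
    unfolding ereal_less_eq by (intro matrix_norm_le) (rule assms, simp_all)
qed

lemma le_cb_norm:
  assumes "1 \<le> n" "matrix_norm n A \<le> 1" "L2_set (\<lambda>j. norm (x j)) {..<n} \<le> 1"
  shows "ereal (L2_set (\<lambda>i. norm (\<Sum>j<n. op_apply (\<Phi> (A i j)) (x j))) {..<n}) \<le> cb_norm \<Phi>"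
proof -
  have "ereal (L2_set (\<lambda>i. norm (\<Sum>j<n. op_apply (\<Phi> (A i j)) (x j))) {..<n})
      \<le> ereal (matrix_norm n (\<lambda>i j. \<Phi> (A i j)))"
    unfolding ereal_less_eq by (rule le_matrix_norm[OF assms(3)])
  also have "\<dots> \<le> cb_norm \<Phi>"
    unfolding cb_norm_def by (rule SUP_upper2[of n], use assms(1) in simp, rule SUP_upper, use assms(2) in simp)
  finally show ?thesis .
qed

text \<open>With the adjoint on the left, \<open>Ad\<close> reverses products, so
  \<open>Ad u \<circ> Ad v\<close> is \<open>Ad (v * u)\<close>.\<close>

lemma Ad_mult: "Ad (u * v) x = Ad v (Ad u x)"
  by (simp add: Ad_def adjoint_op_mult mult.assoc)

text \<open>The amplification of \<open>Ad g\<close> conjugates a matrix by the diagonal unitary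
  with entries \<open>g\<close>, which preserves norms in the direct sum.\<close>

lemma matrix_norm_Ad_le:
  fixes g :: "'a::nonzero_complex_hilbert_space bounded_op"
  assumes "unitary_op g"
  shows "matrix_norm n (\<lambda>i j. Ad g (A i j)) \<le> matrix_norm n A"
proof (rule matrix_norm_le)
  fix x :: "nat \<Rightarrow> 'a"
  assume x: "L2_set (\<lambda>j. norm (x j)) {..<n} \<le> 1"
  have "norm (\<Sum>j<n. op_apply (Ad g (A i j)) (x j)) = norm (\<Sum>j<n. op_apply (A i j) (op_apply g (x j)))" for i
    by (simp add: Ad_def op_apply_mult norm_unitary_apply[OF unitary_op_adjoint[OF assms]]
        flip: op_apply_sum)
  then show "L2_set (\<lambda>i. norm (\<Sum>j<n. op_apply (Ad g (A i j)) (x j))) {..<n} \<le> matrix_norm n A"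
    using le_matrix_norm[of "\<lambda>j. op_apply g (x j)" n A] x by (simp add: norm_unitary_apply[OF assms])
qed

lemma cb_norm_comp_Ad:
  fixes g :: "'a::nonzero_complex_hilbert_space bounded_op"
  assumes g: "unitary_op g"
  shows "cb_norm (\<lambda>x. \<Phi> (Ad g x)) = cb_norm \<Phi>"
proof -
  have le: "cb_norm (\<lambda>x. \<Phi> (Ad g x)) \<le> cb_norm \<Phi>" if "unitary_op g" for \<Phi> and g :: "'a bounded_op"
    unfolding cb_norm_def
  proof (rule SUP_mono)
    fix n :: nat
    assume "n \<in> {1..}"
    have "(SUP A\<in>{A. matrix_norm n A \<le> 1}. ereal (matrix_norm n (\<lambda>i j. \<Phi> (Ad g (A i j)))))
        \<le> (SUP A\<in>{A. matrix_norm n A \<le> 1}. ereal (matrix_norm n (\<lambda>i j. \<Phi> (A i j))))"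
    proof (rule SUP_least)
      fix A :: "nat \<Rightarrow> nat \<Rightarrow> 'a bounded_op"
      assume "A \<in> {A. matrix_norm n A \<le> 1}"
      then have "matrix_norm n (\<lambda>i j. Ad g (A i j)) \<le> 1"
        using matrix_norm_Ad_le[OF that, of n A] by simp
      then show "ereal (matrix_norm n (\<lambda>i j. \<Phi> (Ad g (A i j))))
          \<le> (SUP A\<in>{A. matrix_norm n A \<le> 1}. ereal (matrix_norm n (\<lambda>i j. \<Phi> (A i j))))"
        by (intro SUP_upper2[of "\<lambda>i j. Ad g (A i j)"]) simp_all
    qed
    with \<open>n \<in> {1..}\<close> show "\<exists>m\<in>{1..}.
        (SUP A\<in>{A. matrix_norm n A \<le> 1}. ereal (matrix_norm n (\<lambda>i j. \<Phi> (Ad g (A i j)))))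
        \<le> (SUP A\<in>{A. matrix_norm m A \<le> 1}. ereal (matrix_norm m (\<lambda>i j. \<Phi> (A i j))))"
      by blast
  qed
  \<comment> \<open>The reverse inequality is the same one for \<open>Ad (adjoint_op g)\<close>, the
    inverse of \<open>Ad g\<close>.\<close>
  have "Ad g (Ad (adjoint_op g) x) = Ad (adjoint_op g * g) x" for x
    by (rule Ad_mult[symmetric])
  then have "Ad g (Ad (adjoint_op g) x) = x" for x
    using g by (simp add: unitary_op_def) (simp add: Ad_def adjoint_op_one)
  then have "cb_norm \<Phi> \<le> cb_norm (\<lambda>x. \<Phi> (Ad g x))"
    using le[OF unitary_op_adjoint[OF g], of "\<lambda>x. \<Phi> (Ad g x)"] by simp
  with le[OF g] show ?thesis
    by (rule antisym)
qed

section \<open>Upper and lower bounds for the cb norm of id - Ad w\<close>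

lemma cb_norm_id_minus_Ad_le:
  fixes w :: "'a::nonzero_complex_hilbert_space bounded_op"
  assumes w: "unitary_op w"
  shows "cb_norm (\<lambda>x. x - Ad w x) \<le> ereal (2 * norm (w - z *\<^sub>C 1))"
proof (rule cb_norm_le)
  fix n :: nat and A :: "nat \<Rightarrow> nat \<Rightarrow> 'a bounded_op" and x :: "nat \<Rightarrow> 'a"
  assume A: "matrix_norm n A \<le> 1" and x: "L2_set (\<lambda>j. norm (x j)) {..<n} \<le> 1"
  define T where "T = w - z *\<^sub>C 1"
  have T: "op_apply T y = op_apply w y - z *\<^sub>C y" for y
    by (simp add: T_def op_apply_minus_scalar)
  have contr: "L2_set (\<lambda>i. norm (\<Sum>j<n. op_apply (A i j) (y j))) {..<n} \<le> L2_set (\<lambda>j. norm (y j)) {..<n}" for y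
    using matrix_norm_apply[of A y n] mult_right_mono[OF A L2_set_nonneg[of "\<lambda>j. norm (y j)" "{..<n}"]] by simp
  have scaled: "L2_set (\<lambda>i. norm (op_apply T (y i))) {..<n} \<le> norm T" if "L2_set (\<lambda>j. norm (y j)) {..<n} \<le> 1" for y
  proof -
    have "L2_set (\<lambda>i. norm (op_apply T (y i))) {..<n} \<le> L2_set (\<lambda>i. norm T * norm (y i)) {..<n}"
      by (rule L2_set_mono) (simp_all add: norm_op_apply)
    also have "\<dots> = norm T * L2_set (\<lambda>j. norm (y j)) {..<n}"
      by (rule L2_set_right_distrib[symmetric]) simp
    also have "\<dots> \<le> norm T"
      using mult_left_mono[OF that norm_ge_zero[of T]] by simp
    finally show ?thesis .
  qed
  define y where "y i = (\<Sum>j<n. op_apply (A i j) (x j))" for i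
  \<comment> \<open>The scalar part of \<open>T\<close> commutes with every entry, so
    \<open>T\<close> may replace \<open>w\<close> in the commutator with the matrix.\<close>
  have eq: "(\<Sum>j<n. op_apply (A i j - Ad w (A i j)) (x j))
      = op_apply (adjoint_op w) (op_apply T (y i) - (\<Sum>j<n. op_apply (A i j) (op_apply T (x j))))" for i
  proof -
    have "op_apply T (y i) - (\<Sum>j<n. op_apply (A i j) (op_apply T (x j)))
        = op_apply w (y i) - (\<Sum>j<n. op_apply (A i j) (op_apply w (x j)))"
      by (simp add: T y_def op_apply_diff op_apply_scaleC sum_subtractf flip: scaleC_sum_right)
    then show ?thesis
      by (simp add: op_apply_diff op_apply_left Ad_def y_def sum_subtractf op_apply_sum
          unitary_apply_adjoint[OF w])
  qed
  have "L2_set (\<lambda>i. norm (\<Sum>j<n. op_apply (A i j - Ad w (A i j)) (x j))) {..<n}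
      \<le> L2_set (\<lambda>i. norm (op_apply T (y i)) + norm (\<Sum>j<n. op_apply (A i j) (op_apply T (x j)))) {..<n}"
    by (rule L2_set_mono)
      (simp_all add: eq norm_unitary_apply[OF unitary_op_adjoint[OF w]] norm_triangle_ineq4)
  also have "\<dots> \<le> L2_set (\<lambda>i. norm (op_apply T (y i))) {..<n}
      + L2_set (\<lambda>i. norm (\<Sum>j<n. op_apply (A i j) (op_apply T (x j)))) {..<n}"
    by (rule L2_set_triangle_ineq)
  \<comment> \<open>Each of the two terms of the commutator costs one factor \<open>norm T\<close>,
    since \<open>A\<close> acts as a contraction.\<close>
  also have "\<dots> \<le> norm T + norm T"
  proof (rule add_mono)
    show "L2_set (\<lambda>i. norm (op_apply T (y i))) {..<n} \<le> norm T"
      by (rule scaled) (use contr[of x] x in \<open>simp add: y_def\<close>)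
    show "L2_set (\<lambda>i. norm (\<Sum>j<n. op_apply (A i j) (op_apply T (x j)))) {..<n} \<le> norm T"
      using contr scaled[OF x] by (rule order_trans)
  qed
  finally show "L2_set (\<lambda>i. norm (\<Sum>j<n. op_apply (A i j - Ad w (A i j)) (x j))) {..<n}
      \<le> 2 * norm (w - z *\<^sub>C 1)"
    by (simp add: T_def)
qed

text \<open>The reflection \<open>2 |\<xi>\<rangle>\<langle>\<xi>| - 1\<close> of the \<open>n\<close>-fold direct sum attains the bound at the vector \<open>\<xi>\<close>.\<close>

lemma le_cb_norm_id_minus_Ad:
  fixes w :: "'a::nonzero_complex_hilbert_space bounded_op" and \<xi> :: "nat \<Rightarrow> 'a"
  assumes w: "unitary_op w" and n: "1 \<le> n" and \<xi>: "(\<Sum>j<n. (norm (\<xi> j))\<^sup>2) = 1"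
  shows "ereal (2 * sqrt (1 - (cmod (\<Sum>j<n. cinner (\<xi> j) (op_apply w (\<xi> j))))\<^sup>2))
    \<le> cb_norm (\<lambda>x. x - Ad w x)"
proof -
  \<comment> \<open>These are the entries of the reflection: the rank-one part
    \<open>2 |\<xi> i><\<xi> j|\<close>, minus the identity on the diagonal.\<close>
  have R_ex: "\<exists>R. \<forall>y. op_apply R y = (2 * cinner (\<xi> j) y) *\<^sub>C \<xi> i - (if i = j then y else 0)" for i j
  proof -
    have "bounded_linear (\<lambda>y. (2 * cinner (\<xi> j) y) *\<^sub>C \<xi> i - (if i = j then y else 0))"
    proof (rule bounded_linear_sub)
      show "bounded_linear (\<lambda>y. (2 * cinner (\<xi> j) y) *\<^sub>C \<xi> i)"
      proof (rule bounded_linear_intro)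
        show "norm ((2 * cinner (\<xi> j) y) *\<^sub>C \<xi> i) \<le> norm y * (2 * norm (\<xi> j) * norm (\<xi> i))" for y
          using mult_right_mono[OF cmod_cinner_le[of "\<xi> j" y] norm_ge_zero[of "\<xi> i"]]
          by (simp add: norm_scaleC norm_mult mult_ac)
      qed (simp_all add: cinner_simps scaleC_add_left[symmetric] scaleR_scaleC scaleC_scaleC algebra_simps)
      show "bounded_linear (\<lambda>y. if i = j then y else 0::'a)"
        by (cases "i = j") simp_all
    qed
    moreover have "(2 * cinner (\<xi> j) (c *\<^sub>C y)) *\<^sub>C \<xi> i - (if i = j then c *\<^sub>C y else 0)
        = c *\<^sub>C ((2 * cinner (\<xi> j) y) *\<^sub>C \<xi> i - (if i = j then y else 0))" for c y
      by (simp add: cinner_simps scaleC_diff_right scaleC_scaleC scaleC_zero_right mult_ac)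
    ultimately show ?thesis
      by (rule op_exists) blast
  qed
  define R where "R i j = (SOME R. \<forall>y. op_apply R y
    = (2 * cinner (\<xi> j) y) *\<^sub>C \<xi> i - (if i = j then y else 0))" for i j
  have R: "op_apply (R i j) y = (2 * cinner (\<xi> j) y) *\<^sub>C \<xi> i - (if i = j then y else 0)" for i j y
    unfolding R_def by (rule someI_ex[OF R_ex, THEN spec])
  have R_sum: "(\<Sum>j<n. op_apply (R i j) (x j)) = (2 * (\<Sum>j<n. cinner (\<xi> j) (x j))) *\<^sub>C \<xi> i - x i"
    if "i < n" for i x
    using that by (simp add: R sum_subtractf sum_distrib_left flip: scaleC_sum_left)
  have "matrix_norm n R \<le> 1"
  proof (rule matrix_norm_le)
    fix x :: "nat \<Rightarrow> 'a"
    assume x: "L2_set (\<lambda>j. norm (x j)) {..<n} \<le> 1"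
    define \<sigma> where "\<sigma> = (\<Sum>j<n. cinner (\<xi> j) (x j))"
    have "(\<Sum>i<n. (norm (\<Sum>j<n. op_apply (R i j) (x j)))\<^sup>2)
        = (\<Sum>i<n. 4 * (cmod \<sigma>)\<^sup>2 * (norm (\<xi> i))\<^sup>2 - 4 * Re (cnj \<sigma> * cinner (\<xi> i) (x i)) + (norm (x i))\<^sup>2)"
      by (rule sum.cong)
        (simp_all add: R_sum norm_diff_sq norm_scaleC norm_mult power_mult_distrib cinner_simps flip: \<sigma>_def)
    \<comment> \<open>A reflection is isometric: the two terms in \<open>\<sigma>\<close>
      cancel.\<close>
    also have "\<dots> = 4 * (cmod \<sigma>)\<^sup>2 - 4 * Re (cnj \<sigma> * \<sigma>) + (\<Sum>i<n. (norm (x i))\<^sup>2)"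
      by (simp only: sum.distrib sum_subtractf sum_distrib_left[symmetric] Re_sum[symmetric] \<xi>)
        (simp add: \<sigma>_def)
    also have "\<dots> = (\<Sum>i<n. (norm (x i))\<^sup>2)"
      using cmod_power2[of \<sigma>] by (simp add: power2_eq_square)
    finally show "L2_set (\<lambda>i. norm (\<Sum>j<n. op_apply (R i j) (x j))) {..<n} \<le> 1"
      using x by (simp add: L2_set_def)
  qed
  moreover have "L2_set (\<lambda>j. norm (\<xi> j)) {..<n} \<le> 1"
    by (simp add: L2_set_def \<xi>)
  ultimately have le: "ereal (L2_set (\<lambda>i. norm (\<Sum>j<n. op_apply (R i j - Ad w (R i j)) (\<xi> j))) {..<n})
      \<le> cb_norm (\<lambda>x. x - Ad w x)"
    by (rule le_cb_norm[OF n])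
  define c where "c = (\<Sum>j<n. cinner (\<xi> j) (op_apply w (\<xi> j)))"
  have "complex_of_real (\<Sum>j<n. (norm (\<xi> j))\<^sup>2) = 1"
    by (simp add: \<xi>)
  then have unit: "(\<Sum>j<n. cinner (\<xi> j) (\<xi> j)) = 1"
    by (simp add: cinner_norm)
  have "(norm (\<Sum>j<n. op_apply (R i j - Ad w (R i j)) (\<xi> j)))\<^sup>2
      = 4 * (norm (\<xi> i))\<^sup>2 - 8 * Re (cnj c * cinner (\<xi> i) (op_apply w (\<xi> i)))
        + 4 * (cmod c)\<^sup>2 * (norm (\<xi> i))\<^sup>2" if "i < n" for i
  proof -
    have "(\<Sum>j<n. op_apply (R i j - Ad w (R i j)) (\<xi> j))
        = (\<Sum>j<n. op_apply (R i j) (\<xi> j))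
          - op_apply (adjoint_op w) (\<Sum>j<n. op_apply (R i j) (op_apply w (\<xi> j)))"
      by (simp add: op_apply_left Ad_def sum_subtractf op_apply_sum)
    \<comment> \<open>The reflection fixes \<open>\<xi>\<close> and sends \<open>w \<xi>\<close> to
      \<open>2 c \<xi> - w \<xi>\<close>. Applying the adjoint of \<open>w\<close> and subtracting,
      the two copies of \<open>\<xi>\<close> add up; this is the source of the factor 2.\<close>
    also have "\<dots> = 2 *\<^sub>C (\<xi> i - c *\<^sub>C op_apply (adjoint_op w) (\<xi> i))"
      using scaleR_scaleC[of 2 "\<xi> i"] that
      by (simp add: R_sum unit op_apply_diff op_apply_scaleC unitary_apply_adjoint[OF w]
          scaleC_diff_right scaleC_scaleC flip: c_def)
    finally have "(norm (\<Sum>j<n. op_apply (R i j - Ad w (R i j)) (\<xi> j)))\<^sup>2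
        = 4 * (norm (\<xi> i - c *\<^sub>C op_apply (adjoint_op w) (\<xi> i)))\<^sup>2"
      by (simp add: norm_scaleC power_mult_distrib)
    moreover have "Re (cinner (\<xi> i) (c *\<^sub>C op_apply (adjoint_op w) (\<xi> i)))
        = Re (cnj c * cinner (\<xi> i) (op_apply w (\<xi> i)))"
      using Re_cinner_commute[of "\<xi> i" "c *\<^sub>C op_apply (adjoint_op w) (\<xi> i)"]
      by (simp add: cinner_simps cinner_adjoint_left)
    ultimately show ?thesis
      by (simp add: norm_diff_sq norm_scaleC power_mult_distrib
          norm_unitary_apply[OF unitary_op_adjoint[OF w]])
  qed
  then have "(\<Sum>i<n. (norm (\<Sum>j<n. op_apply (R i j - Ad w (R i j)) (\<xi> j)))\<^sup>2)
      = (\<Sum>i<n. 4 * (norm (\<xi> i))\<^sup>2 - 8 * Re (cnj c * cinner (\<xi> i) (op_apply w (\<xi> i)))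
        + 4 * (cmod c)\<^sup>2 * (norm (\<xi> i))\<^sup>2)"
    by (intro sum.cong) simp_all
  also have "\<dots> = 4 - 8 * Re (cnj c * c) + 4 * (cmod c)\<^sup>2"
    by (simp only: sum.distrib sum_subtractf sum_distrib_left[symmetric] Re_sum[symmetric] \<xi>)
      (simp add: c_def)
  also have "\<dots> = 4 * (1 - (cmod c)\<^sup>2)"
    using cmod_power2[of c] by (simp add: power2_eq_square)
  finally have "L2_set (\<lambda>i. norm (\<Sum>j<n. op_apply (R i j - Ad w (R i j)) (\<xi> j))) {..<n}
      = 2 * sqrt (1 - (cmod c)\<^sup>2)"
    unfolding L2_set_def by (simp only: real_sqrt_mult) simp
  with le show ?thesis
    by (simp add: c_def)
qed

text \<open>A convex combination of spectral values is almost attained by the direct sum of approximate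
  eigenvectors, weighted with the square roots of the coefficients.\<close>

lemma le_cb_norm_id_minus_Ad_hull:
  fixes w :: "'a::nonzero_complex_hilbert_space bounded_op"
  assumes w: "unitary_op w" and c: "c \<in> convex hull (spectrum_op w)"
  shows "ereal (2 * sqrt (1 - (cmod c)\<^sup>2)) \<le> cb_norm (\<lambda>x. x - Ad w x)"
proof -
  obtain n :: nat and p \<mu> where p0: "\<And>j. j < n \<Longrightarrow> 0 \<le> p j" and \<mu>: "\<And>j. j < n \<Longrightarrow> \<mu> j \<in> spectrum_op w"
    and p1: "(\<Sum>j<n. p j) = (1::real)" and c_eq: "(\<Sum>j<n. p j *\<^sub>R \<mu> j) = c"
  proof -
    obtain k :: nat and u v where "\<forall>i\<in>{1..k}. 0 \<le> u i \<and> v i \<in> spectrum_op w" "sum u {1..k} = 1"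
      "(\<Sum>i = 1..k. u i *\<^sub>R v i) = c"
      using c unfolding convex_hull_indexed by blast
    \<comment> \<open>The indexed description of the hull counts from 1, the direct sum from
      0.\<close>
    then show thesis
      by (intro that[of k "\<lambda>i. u (Suc i)" "\<lambda>i. v (Suc i)"]) (simp_all add: sum.atLeast1_atMost_eq)
  qed
  have n: "1 \<le> n"
    using p1 by (cases n) simp_all
  have approx: "ereal (2 * sqrt (1 - (cmod c + e)\<^sup>2)) \<le> cb_norm (\<lambda>x. x - Ad w x)" if "0 < e" for e
  proof -
    \<comment> \<open>The guard \<open>j < n\<close> under the quantifier lets a choice function be
      total in \<open>j\<close>.\<close>
    have "\<exists>x. j < n \<longrightarrow> norm x = 1 \<and> norm (op_apply w x - \<mu> j *\<^sub>C x) < e" for j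
      using \<mu>[of j] \<open>0 < e\<close> unfolding unitary_spectrum_iff[OF w] by blast
    then obtain x where x: "\<And>j. j < n \<Longrightarrow> norm (x j) = 1"
      "\<And>j. j < n \<Longrightarrow> norm (op_apply w (x j) - \<mu> j *\<^sub>C x j) < e"
      by metis
    define \<xi> where "\<xi> j = complex_of_real (sqrt (p j)) *\<^sub>C x j" for j
    have "(\<Sum>j<n. (norm (\<xi> j))\<^sup>2) = 1"
      using p0 x(1) p1 by (simp add: \<xi>_def norm_scaleC power_mult_distrib)
    then have le: "ereal (2 * sqrt (1 - (cmod (\<Sum>j<n. cinner (\<xi> j) (op_apply w (\<xi> j))))\<^sup>2))
        \<le> cb_norm (\<lambda>x. x - Ad w x)"
      by (rule le_cb_norm_id_minus_Ad[OF w n])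
    have "cmod (cinner (\<xi> j) (op_apply w (\<xi> j)) - p j *\<^sub>R \<mu> j) \<le> p j * e" if "j < n" for j
    proof -
      have "complex_of_real (sqrt (p j)) * complex_of_real (sqrt (p j)) = complex_of_real (p j)"
        using p0[OF that] by (simp flip: of_real_mult)
      then have "cinner (\<xi> j) (op_apply w (\<xi> j)) = complex_of_real (p j) * cinner (x j) (op_apply w (x j))"
        by (simp add: \<xi>_def op_apply_scaleC cinner_simps mult.assoc[symmetric])
      moreover have "cinner (x j) (op_apply w (x j)) - \<mu> j = cinner (x j) (op_apply w (x j) - \<mu> j *\<^sub>C x j)"
        using x(1)[OF that] by (simp add: cinner_simps cinner_norm)
      ultimately have "cinner (\<xi> j) (op_apply w (\<xi> j)) - p j *\<^sub>R \<mu> j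
          = complex_of_real (p j) * cinner (x j) (op_apply w (x j) - \<mu> j *\<^sub>C x j)"
        by (simp add: scaleR_conv_of_real flip: right_diff_distrib)
      then have "cmod (cinner (\<xi> j) (op_apply w (\<xi> j)) - p j *\<^sub>R \<mu> j)
          = p j * cmod (cinner (x j) (op_apply w (x j) - \<mu> j *\<^sub>C x j))"
        using p0[OF that] by (simp add: norm_mult)
      also have "\<dots> \<le> p j * e"
        using cmod_cinner_le[of "x j" "op_apply w (x j) - \<mu> j *\<^sub>C x j"] x[OF that]
        by (intro mult_left_mono p0 that) simp
      finally show ?thesis .
    qed
    then have "cmod (\<Sum>j<n. cinner (\<xi> j) (op_apply w (\<xi> j)) - p j *\<^sub>R \<mu> j) \<le> (\<Sum>j<n. p j * e)"
      by (intro sum_norm_le) simp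
    then have "cmod ((\<Sum>j<n. cinner (\<xi> j) (op_apply w (\<xi> j))) - c) \<le> e"
      by (simp add: sum_subtractf c_eq p1 flip: sum_distrib_right)
    then have "cmod (\<Sum>j<n. cinner (\<xi> j) (op_apply w (\<xi> j))) \<le> cmod c + e"
      using norm_triangle_sub[of "\<Sum>j<n. cinner (\<xi> j) (op_apply w (\<xi> j))" c] by linarith
    \<comment> \<open>The function \<open>sqrt\<close> is monotone on all reals, with negative
      values at negative arguments, so \<open>e\<close> may be large enough to make
      \<open>cmod c + e\<close> exceed 1.\<close>
    then have "2 * sqrt (1 - (cmod c + e)\<^sup>2) \<le> 2 * sqrt (1 - (cmod (\<Sum>j<n. cinner (\<xi> j) (op_apply w (\<xi> j))))\<^sup>2)"
      by (simp add: power_mono)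
    with le show ?thesis
      by (meson ereal_less_eq(3) order_trans)
  qed
  have "(\<lambda>k. ereal (2 * sqrt (1 - (cmod c + inverse (real (Suc k)))\<^sup>2))) \<longlonglongrightarrow> ereal (2 * sqrt (1 - (cmod c + 0)\<^sup>2))"
    by (intro tendsto_ereal tendsto_intros LIMSEQ_inverse_real_of_nat)
  then have "ereal (2 * sqrt (1 - (cmod c + 0)\<^sup>2)) \<le> cb_norm (\<lambda>x. x - Ad w x)"
    by (rule LIMSEQ_le_const2) (use approx in auto)
  then show ?thesis
    by simp
qed

section \<open>The commutator formula\<close>

lemma norm_minus_scalar_le:
  fixes w :: "'a::nonzero_complex_hilbert_space bounded_op"
  assumes w: "unitary_op w" and support: "\<And>\<mu>. \<mu> \<in> spectrum_op w \<Longrightarrow> (cmod c)\<^sup>2 \<le> Re (cnj c * \<mu>)"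
  shows "norm (w - c *\<^sub>C 1) \<le> sqrt (1 - (cmod c)\<^sup>2)"
proof (cases "c = 0")
  \<comment> \<open>A zero \<open>c\<close> gives no direction for the support lemma, but then the
    claim is \<open>norm w \<le> 1\<close>.\<close>
  case True
  then show ?thesis
    by (auto simp: scaleC_zero_left norm_unitary_apply[OF w] intro!: norm_op_le)
next
  case False
  obtain \<mu> where \<mu>: "\<mu> \<in> spectrum_op w"
    "\<And>x. norm x = 1 \<Longrightarrow> Re (cnj c * \<mu>) \<le> Re (cnj c * cinner x (op_apply w x))"
    using unitary_numerical_range_support[OF w False] by blast
  have unit: "(norm (op_apply (w - c *\<^sub>C 1) x))\<^sup>2 \<le> 1 - (cmod c)\<^sup>2" if "norm x = 1" for x
  proof -
    have "(cmod c)\<^sup>2 \<le> Re (cnj c * cinner x (op_apply w x))"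
      using support[OF \<mu>(1)] \<mu>(2)[OF that] by (rule order_trans)
    also have "\<dots> = Re (cinner (op_apply w x) (c *\<^sub>C x))"
      using Re_cinner_commute[of "op_apply w x" "c *\<^sub>C x"] by (simp add: cinner_simps)
    finally show ?thesis
      using that by (simp add: op_apply_minus_scalar norm_diff_sq norm_scaleC norm_unitary_apply[OF w])
  qed
  show ?thesis
  proof (rule norm_op_le)
    fix x
    show "norm (op_apply (w - c *\<^sub>C 1) x) \<le> sqrt (1 - (cmod c)\<^sup>2) * norm x"
    proof (cases "x = 0")
      case False
      define y where "y = complex_of_real (1 / norm x) *\<^sub>C x"
      have "norm y = 1"
        using False by (simp add: y_def norm_scaleC norm_divide)
      then have "norm (op_apply (w - c *\<^sub>C 1) y) \<le> sqrt (1 - (cmod c)\<^sup>2)"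
        by (intro real_le_rsqrt unit)
      then show ?thesis
        using False by (simp add: y_def op_apply_scaleC norm_scaleC norm_divide field_simps)
    qed (simp add: op_apply_0)
    \<comment> \<open>The bound is nonnegative because, by \<open>unit\<close>,
      \<open>1 - (cmod c)\<^sup>2\<close> dominates a square as soon as a unit vector
      exists.\<close>
    obtain y :: 'a where "y \<noteq> 0"
      using ex_nonzero by blast
    then have "norm (y /\<^sub>R norm y) = 1"
      by simp
    then show "0 \<le> sqrt (1 - (cmod c)\<^sup>2)"
      using unit by (metis order_trans real_sqrt_ge_zero zero_le_power2)
  qed
qed

lemma cb_commutator_eq:
  assumes "selfadjoint_op a" "selfadjoint_op b"
  shows "cb_commutator a b s t = cb_norm (\<lambda>x. x - Ad (group_commutator a b s t) x)"
    and "unitary_op (group_commutator a b s t)"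
proof -
  define u where "u = exp ((\<i> * complex_of_real s) *\<^sub>C a)"
  define v where "v = exp ((\<i> * complex_of_real t) *\<^sub>C b)"
  have u: "unitary_op u" and v: "unitary_op v"
    unfolding u_def v_def by (rule unitary_op_exp(1)[OF assms(1)] unitary_op_exp(1)[OF assms(2)])+
  have w: "group_commutator a b s t = adjoint_op u * adjoint_op v * u * v"
    by (simp only: u_def v_def group_commutator_def unitary_op_exp(2)[OF assms(1)] unitary_op_exp(2)[OF assms(2)])
  show "unitary_op (group_commutator a b s t)"
    unfolding w by (intro unitary_op_mult unitary_op_adjoint u v)
  \<comment> \<open>Since \<open>Ad\<close> reverses products, the two compositions are
    \<open>Ad (v * u)\<close> and \<open>Ad (u * v)\<close>; thus \<open>Ad (v * u)\<close> acts
    first and id - Ad w after it.\<close>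
  have "v * u * group_commutator a b s t = v * (u * adjoint_op u) * adjoint_op v * u * v"
    by (simp add: w mult.assoc)
  also have "\<dots> = u * v"
    using u v by (simp add: unitary_op_def)
  finally have "Ad v (Ad u x) = Ad (group_commutator a b s t) (Ad (v * u) x)" for x
    by (simp flip: Ad_mult)
  then have "cb_commutator a b s t
      = cb_norm (\<lambda>x. (\<lambda>y. y - Ad (group_commutator a b s t) y) (Ad (v * u) x))"
    by (simp add: cb_commutator_def Let_def flip: u_def v_def) (simp add: Ad_mult)
  also have "\<dots> = cb_norm (\<lambda>x. x - Ad (group_commutator a b s t) x)"
    by (rule cb_norm_comp_Ad[OF unitary_op_mult[OF v u]])
  finally show "cb_commutator a b s t = cb_norm (\<lambda>x. x - Ad (group_commutator a b s t) x)" .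
qed

theorem proposition4p6:
  fixes a b w :: "'a::nonzero_complex_hilbert_space bounded_op" and s t :: real
  assumes "selfadjoint_op a" and "selfadjoint_op b"
    and "w = group_commutator a b s t"
  shows "cb_commutator a b s t = cb_norm (\<lambda>x. x - Ad w x)
    \<and> cb_norm (\<lambda>x. x - Ad w x) = ereal (2 * (INF z. norm (w - z *\<^sub>C 1)))
    \<and> 2 * (INF z. norm (w - z *\<^sub>C 1)) = 2 * sqrt (1 - (spectral_dist w)\<^sup>2)
    \<and> 2 * sqrt (1 - (spectral_dist w)\<^sup>2) = 2 * sin (1/2 * min (spectral_arc w) pi)"
proof -
  have w: "unitary_op w"
    unfolding assms(3) by (rule cb_commutator_eq(2)[OF assms(1,2)])
  note spectrum = unitary_spectrum_compact[OF w] unitary_spectrum_nonempty[OF w]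
  obtain c where c: "c \<in> convex hull (spectrum_op w)" "cmod c = spectral_dist w"
    and support: "\<And>z. z \<in> spectrum_op w \<Longrightarrow> (cmod c)\<^sup>2 \<le> Re (cnj c * z)"
    using infdist_convex_hull_support[OF spectrum] unfolding spectral_dist_def by metis
  define \<rho> where "\<rho> = sqrt (1 - (cmod c)\<^sup>2)"
  have lower: "ereal (2 * \<rho>) \<le> cb_norm (\<lambda>x. x - Ad w x)"
    unfolding \<rho>_def by (rule le_cb_norm_id_minus_Ad_hull[OF w c(1)])
  have upper: "cb_norm (\<lambda>x. x - Ad w x) \<le> ereal (2 * norm (w - z *\<^sub>C 1))" for z
    by (rule cb_norm_id_minus_Ad_le[OF w])
  have norm_le: "norm (w - c *\<^sub>C 1) \<le> \<rho>"
    unfolding \<rho>_def by (rule norm_minus_scalar_le[OF w support])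
  have "(INF z. norm (w - z *\<^sub>C 1)) = \<rho>"
  proof (rule antisym)
    have "(INF z. norm (w - z *\<^sub>C 1)) \<le> norm (w - c *\<^sub>C 1)"
      by (intro cINF_lower bdd_belowI2[of _ 0]) simp_all
    then show "(INF z. norm (w - z *\<^sub>C 1)) \<le> \<rho>"
      using norm_le by (rule order_trans)
    \<comment> \<open>The cb norm certifies the distance to the scalars: its lower bound together
      with the upper bound for an arbitrary \<open>z\<close> leaves no scalar nearer than
      \<open>\<rho>\<close>.\<close>
    have "\<rho> \<le> norm (w - z *\<^sub>C 1)" for z
      using order_trans[OF lower upper[of z]] by simp
    then show "\<rho> \<le> (INF z. norm (w - z *\<^sub>C 1))"
      by (intro cINF_greatest) simp_all
  qed
  moreover have "cb_norm (\<lambda>x. x - Ad w x) = ereal (2 * \<rho>)"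
  proof (rule antisym[OF _ lower])
    show "cb_norm (\<lambda>x. x - Ad w x) \<le> ereal (2 * \<rho>)"
      by (rule order_trans[OF upper[of c]]) (simp add: norm_le)
  qed
  moreover have "sqrt (1 - (spectral_dist w)\<^sup>2) = sin (1/2 * min (spectral_arc w) pi)"
    unfolding spectral_dist_def spectral_arc_def
    by (rule sqrt_infdist_eq_sin_arc[OF spectrum unitary_spectrum_circle[OF w]])
  ultimately show ?thesis
    using cb_commutator_eq(1)[OF assms(1,2), of s t] by (simp add: \<rho>_def c(2) flip: assms(3))
qed

end
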